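(* Let $\alpha,\theta$ be two non-constant inner functions and let $C$ be a conjugation on $L^2(\mathbb{T})$ such that $CM_{z^2}=M_{\bar z^2}C$. Suppose that (i) $C(K_\alpha)\subset K_\theta$ and $M_zCM_z(K_\alpha)\subset K_\theta$, (ii) $\mathrm{Re}\big[(M_zCJM_{\bar z})^*(CJ)\big]=I$. Then there exists an inner function $\gamma$ such that $C+M_zCM_z=2\,\mathscr{C}_\gamma$, where $\gamma$ is divisible by $\alpha$ and $\gamma$ divides $\theta$ (that is, $\alpha\le\gamma\le\theta$).
   Context: $\mathbb{T}$ is the unit circle with normalized Lebesgue measure; $H^2\subset L^2(\mathbb{T})$ is the Hardy space (functions whose negative Fourier coefficients vanish) and $H^\infty=H^2\cap L^\infty(\mathbb{T})$. An inner function is $\theta\in H^\infty$ with $|\theta|=1$ a.e. on $\mathbb{T}$; its model space is $K_\theta=H^2\ominus\theta H^2$. For inner functions, $\alpha\le\gamma$ ($\alpha$ divides $\gamma$) means $\gamma\overline{\alpha}$ is an inner function. A conjugation on a Hilbert space $\mathcal{H}$ is an antilinear map $C:\mathcal{H}\to\mathcal{H}$ with $C^2=I$ and $\langle Cf,Cg\rangle=\langle g,f\rangle$ for all $f,g$. On $L^2(\mathbb{T})$: $M_\phi f=\phi f$ for $\phi\in L^\infty(\mathbb{T})$; $J$ is the conjugation $Jf=\overline f$; for an inner function $\gamma$, $\mathscr{C}_\gamma$ is the conjugation $\mathscr{C}_\gamma f=\gamma\,\overline{zf}$. For a bounded linear operator $T$, $\mathrm{Re}[T]=\frac12(T+T^*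 )$. *)

theory Defs
  imports "HOL-Analysis.Analysis" "HOL-Probability.Probability_Measure"
begin

text \<open>The unit circle with normalized Lebesgue measure, carried by the complex plane: functions on
  the circle are functions on the plane, and \<open>AE z in circle\<close> only sees their values at \<open>|z| = 1\<close>.\<close>

definition circle :: "complex measure" where
  "circle = distr (uniform_measure lborel {0..<2 * pi}) borel cis"

definition square_integrable :: "(complex \<Rightarrow> complex) \<Rightarrow> bool" where
  "square_integrable f \<longleftrightarrow>
     f \<in> borel_measurable circle \<and> integrable circle (\<lambda>z. (cmod (f z))\<^sup>2)"

lemma sets_circle [measurable_cong, simp]: "sets circle = sets borel"
  by (simp add: circle_def)

lemma space_circle [simp]: "space circle = UNIV"
  by (simp add: circle_def)

lemma cis_measurable: "cis \<in> borel_measurable (uniform_measure lborel {0..<2 * pi})"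
proof -
  have "continuous_on UNIV cis"
    by (intro continuous_intros)
  then show ?thesis
    using borel_measurable_continuous_onI[of cis] by (simp add: measurable_def)
qed

lemma prob_space_uniform: "prob_space (uniform_measure lborel {0..<2 * pi})"
  by (rule prob_space_uniform_measure) auto

lemma prob_space_circle: "prob_space circle"
  unfolding circle_def by (rule prob_space.prob_space_distr[OF prob_space_uniform cis_measurable])

lemma AE_circle_norm: "AE z in circle. cmod z = 1"
  unfolding circle_def by (subst AE_distr_iff[OF cis_measurable]) auto

lemma square_integrableI_bounded:
  assumes "f \<in> borel_measurable borel" "AE z in circle. cmod (f z) \<le> B"
  shows "square_integrable f"
proof -
  interpret prob_space circle by (rule prob_space_circle)
  have m[measurable]: "f \<in> borel_measurable circle"
    using assms(1) by (simp cong: measurable_cong_sets)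
  have "AE z in circle. norm ((cmod (f z))\<^sup>2) \<le> B\<^sup>2"
    using assms(2) by eventually_elim (simp add: power_mono)
  then have "integrable circle (\<lambda>z. (cmod (f z))\<^sup>2)"
    by (intro integrable_const_bound[where B = "B\<^sup>2"]) auto
  then show ?thesis using m by (simp add: square_integrable_def)
qed

lemma square_integrable_add:
  assumes "square_integrable f" "square_integrable g"
  shows "square_integrable (\<lambda>z. f z + g z)"
proof -
  have [measurable]: "f \<in> borel_measurable circle" "g \<in> borel_measurable circle"
    using assms by (auto simp: square_integrable_def)
  have "integrable circle (\<lambda>z. 2 * (cmod (f z))\<^sup>2 + 2 * (cmod (g z))\<^sup>2)"
    using assms by (auto simp: square_integrable_def)
  then have "integrable circle (\<lambda>z. (cmod (f z + g z))\<^sup>2)"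
  proof (rule Bochner_Integration.integrable_bound)
    have "(cmod (f z + g z))\<^sup>2 \<le> 2 * (cmod (f z))\<^sup>2 + 2 * (cmod (g z))\<^sup>2" for z
    proof -
      have "(cmod (f z + g z))\<^sup>2 \<le> (cmod (f z) + cmod (g z))\<^sup>2"
        by (intro power_mono norm_triangle_ineq) auto
      also have "\<dots> \<le> 2 * (cmod (f z))\<^sup>2 + 2 * (cmod (g z))\<^sup>2"
        using sum_squares_ge_zero[of "cmod (f z) - cmod (g z)" 0]
        by (simp add: power2_eq_square algebra_simps)
      finally show ?thesis .
    qed
    then show "AE z in circle. norm ((cmod (f z + g z))\<^sup>2)
        \<le> norm (2 * (cmod (f z))\<^sup>2 + 2 * (cmod (g z))\<^sup>2)"
      by (auto simp: abs_of_nonneg)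
  qed simp
  then show ?thesis by (simp add: square_integrable_def)
qed

lemma square_integrable_scale:
  "square_integrable f \<Longrightarrow> square_integrable (\<lambda>z. c * f z)"
  by (auto simp: square_integrable_def norm_mult power_mult_distrib)

lemma square_integrable_cnj:
  assumes "square_integrable f"
  shows "square_integrable (\<lambda>z. cnj (f z))"
proof -
  have [measurable]: "f \<in> borel_measurable circle"
    using assms by (simp add: square_integrable_def)
  have "(\<lambda>z. cnj (f z)) \<in> borel_measurable circle"
    by (rule measurable_compose[OF _ borel_measurable_continuous_onI])
       (auto intro!: continuous_intros)
  then show ?thesis using assms by (simp add: square_integrable_def)
qed

lemma square_integrable_powi: "square_integrable (\<lambda>z. z powi n)"
proof (rule square_integrableI_bounded[where B = 1])
  show "(\<lambda>z::complex. z powi n) \<in> borel_measurable borel"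
    by (cases "n \<ge> 0") (simp_all add: power_int_def)
  show "AE z in circle. cmod (z powi n) \<le> 1"
    using AE_circle_norm by eventually_elim (simp add: norm_power_int)
qed

text \<open>The space \<open>L\<^sup>2\<close> of the circle: square-integrable functions modulo equality almost everywhere.\<close>

quotient_type L2 = "complex \<Rightarrow> complex" / partial:
  "\<lambda>f g. square_integrable f \<and> square_integrable g \<and> (AE z in circle. f z = g z)"
proof (rule part_equivpI)
  show "\<exists>f. square_integrable f \<and> square_integrable f \<and> (AE z in circle. f z = f z)"
    by (rule exI[of _ "\<lambda>z. z powi 0"]) (use square_integrable_powi[of 0] in simp)
  show "symp (\<lambda>f g. square_integrable f \<and> square_integrable g \<and> (AE z in circle. f z = g z))"
    by (auto simp: symp_def elim: eventually_mono)
  show "transp (\<lambda>f g. square_integrable f \<and> square_integrable g \<and> (AE z in circle. f z = g z))"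
    unfolding transp_def
  proof (intro allI impI, elim conjE, intro conjI)
    fix f g h :: "complex \<Rightarrow> complex"
    assume "AE z in circle. f z = g z" "AE z in circle. g z = h z"
    then show "AE z in circle. f z = h z" by eventually_elim simp
  qed auto
qed

instantiation L2 :: ab_group_add
begin

lift_definition zero_L2 :: L2 is "\<lambda>_. 0"
  by (auto simp: square_integrable_def)

lift_definition plus_L2 :: "L2 \<Rightarrow> L2 \<Rightarrow> L2" is "\<lambda>f g z. f z + g z"
  by (auto intro: square_integrable_add elim: eventually_elim2)

lift_definition uminus_L2 :: "L2 \<Rightarrow> L2" is "\<lambda>f z. - f z"
  using square_integrable_scale[of _ "- 1"] by (auto elim: eventually_mono)

definition minus_L2 :: "L2 \<Rightarrow> L2 \<Rightarrow> L2" where "minus_L2 f g = f + - g"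

instance
proof
  fix a b c :: L2
  show "a + b + c = a + (b + c)"
    by transfer (auto simp: add.assoc intro!: square_integrable_add)
  show "a + b = b + a"
    by transfer (auto simp: add.commute intro!: square_integrable_add)
  show "0 + a = a"
    by transfer auto
  show "- a + a = 0"
    by transfer (auto simp: square_integrable_def)
  show "a - b = a + - b"
    by (simp add: minus_L2_def)
qed

end

lift_definition cscale :: "complex \<Rightarrow> L2 \<Rightarrow> L2" is "\<lambda>c f z. c * f z"
  by (auto intro: square_integrable_scale elim: eventually_mono)

lift_definition ip :: "L2 \<Rightarrow> L2 \<Rightarrow> complex" is "\<lambda>f g. LINT z|circle. f z * cnj (g z)"
proof (elim conjE)
  fix f f' g g' :: "complex \<Rightarrow> complex"
  assume sq: "square_integrable f" "square_integrable f'" "square_integrable g" "square_integrable g'"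
    and eq: "AE z in circle. f z = f' z" "AE z in circle. g z = g' z"
  have [measurable]: "f \<in> borel_measurable circle" "f' \<in> borel_measurable circle"
      "(\<lambda>z. cnj (g z)) \<in> borel_measurable circle" "(\<lambda>z. cnj (g' z)) \<in> borel_measurable circle"
    using sq sq[THEN square_integrable_cnj] by (auto simp: square_integrable_def)
  show "(LINT z|circle. f z * cnj (g z)) = (LINT z|circle. f' z * cnj (g' z))"
    using eq by (intro integral_cong_AE) (auto elim: eventually_elim2)
qed

text \<open>The monomial \<open>z\<^sup>n\<close>; since \<open>|z| = 1\<close> almost everywhere, \<open>monomial (- n)\<close> is the conjugate
  \<open>\<bar>z\<^sup>n\<close> of \<open>monomial n\<close>.\<close>

lift_definition monomial :: "int \<Rightarrow> L2" is "\<lambda>n z. z powi n"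
  by (auto intro: square_integrable_powi)

definition fourier :: "L2 \<Rightarrow> int \<Rightarrow> complex" where
  "fourier f n = ip f (monomial n)"

definition Hardy2 :: "L2 set" where
  "Hardy2 = {f. \<forall>n<0. fourier f n = 0}"

lift_definition ess_bounded :: "L2 \<Rightarrow> bool" is "\<lambda>f. \<exists>B::real. AE z in circle. cmod (f z) \<le> B"
  by (auto intro!: iff_exI eventually_subst elim: eventually_mono)

definition Linfty :: "L2 set" where
  "Linfty = {f. ess_bounded f}"

definition Hinfty :: "L2 set" where
  "Hinfty = Hardy2 \<inter> Linfty"

text \<open>The multiplication operator \<open>M\<^sub>\<phi>\<close>. It is only meant for \<open>\<phi> \<in> Linfty\<close>, where
  \<open>\<phi> f\<close> is always square-integrable (\<open>square_integrable_mult\<close> below), so the second branch is never taken.\<close>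

lift_definition Mult :: "L2 \<Rightarrow> L2 \<Rightarrow> L2" is
  "\<lambda>\<phi> f. if square_integrable (\<lambda>z. \<phi> z * f z) then (\<lambda>z. \<phi> z * f z) else (\<lambda>_. 0)"
proof (elim conjE)
  fix p p' f f' :: "complex \<Rightarrow> complex"
  assume sq: "square_integrable p" "square_integrable p'" "square_integrable f" "square_integrable f'"
    and eq: "AE z in circle. p z = p' z" "AE z in circle. f z = f' z"
  have [measurable]: "p \<in> borel_measurable circle" "p' \<in> borel_measurable circle"
      "f \<in> borel_measurable circle" "f' \<in> borel_measurable circle"
    using sq by (auto simp: square_integrable_def)
  have prod: "AE z in circle. p z * f z = p' z * f' z"
    using eq by eventually_elim simp
  have "integrable circle (\<lambda>z. (cmod (p z * f z))\<^sup>2) \<longleftrightarrow> integrable circle (\<lambda>z. (cmod (p' z * f' z))\<^sup>2)"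
    using prod by (intro integrable_cong_AE) (auto elim: eventually_mono)
  then have "square_integrable (\<lambda>z. p z * f z) \<longleftrightarrow> square_integrable (\<lambda>z. p' z * f' z)"
    by (simp add: square_integrable_def)
  moreover have "square_integrable (\<lambda>_. 0)"
    by (simp add: square_integrable_def)
  ultimately show "square_integrable (if square_integrable (\<lambda>z. p z * f z) then \<lambda>z. p z * f z else (\<lambda>_. 0)) \<and>
      square_integrable (if square_integrable (\<lambda>z. p' z * f' z) then \<lambda>z. p' z * f' z else (\<lambda>_. 0)) \<and>
      (AE z in circle. (if square_integrable (\<lambda>z. p z * f z) then \<lambda>z. p z * f z else (\<lambda>_. 0)) z =
         (if square_integrable (\<lambda>z. p' z * f' z) then \<lambda>z. p' z * f' z else (\<lambda>_. 0)) z)"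
    using prod by auto
qed

lemma square_integrable_mult:
  assumes "square_integrable p" "\<exists>B::real. AE z in circle. cmod (p z) \<le> B" "square_integrable f"
  shows "square_integrable (\<lambda>z. p z * f z)"
proof -
  have [measurable]: "p \<in> borel_measurable circle" "f \<in> borel_measurable circle"
    using assms by (auto simp: square_integrable_def)
  obtain B where B: "AE z in circle. cmod (p z) \<le> B"
    using assms(2) by blast
  have "integrable circle (\<lambda>z. B\<^sup>2 * (cmod (f z))\<^sup>2)"
    using assms(3) by (auto simp: square_integrable_def)
  then have "integrable circle (\<lambda>z. (cmod (p z * f z))\<^sup>2)"
  proof (rule Bochner_Integration.integrable_bound)
    show "AE z in circle. norm ((cmod (p z * f z))\<^sup>2) \<le> norm (B\<^sup>2 * (cmod (f z))\<^sup>2)"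
      using B by eventually_elim
        (auto simp: norm_mult power_mult_distrib intro!: mult_right_mono power_mono)
  qed simp
  then show ?thesis by (simp add: square_integrable_def)
qed

lift_definition J :: "L2 \<Rightarrow> L2" is "\<lambda>f z. cnj (f z)"
  by (auto intro: square_integrable_cnj elim: eventually_mono)

lift_definition unimodular :: "L2 \<Rightarrow> bool" is "\<lambda>f. AE z in circle. cmod (f z) = 1"
  by (auto intro!: eventually_subst elim: eventually_mono)

definition inner_function :: "L2 \<Rightarrow> bool" where
  "inner_function \<theta> \<longleftrightarrow> \<theta> \<in> Hinfty \<and> unimodular \<theta>"

definition constant_function :: "L2 \<Rightarrow> bool" where
  "constant_function f \<longleftrightarrow> (\<exists>c. f = cscale c (monomial 0))"

definition inner_divides :: "L2 \<Rightarrow> L2 \<Rightarrow> bool" where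
  "inner_divides \<alpha> \<gamma> \<longleftrightarrow> inner_function (Mult \<gamma> (J \<alpha>))"

definition model_space :: "L2 \<Rightarrow> L2 set" where
  "model_space \<theta> = {f \<in> Hardy2. \<forall>h \<in> Mult \<theta> ` Hardy2. ip f h = 0}"

definition conjugation :: "(L2 \<Rightarrow> L2) \<Rightarrow> bool" where
  "conjugation C \<longleftrightarrow>
     (\<forall>f g. C (f + g) = C f + C g) \<and> (\<forall>c f. C (cscale c f) = cscale (cnj c) (C f)) \<and>
     C \<circ> C = id \<and> (\<forall>f g. ip (C f) (C g) = ip g f)"

definition conj_inner :: "L2 \<Rightarrow> L2 \<Rightarrow> L2" where
  "conj_inner \<gamma> f = Mult \<gamma> (J (Mult (monomial 1) f))"

text \<open>The Hilbert space adjoint; the description is proper for every bounded linear \<open>T\<close>.\<close>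

definition adj :: "(L2 \<Rightarrow> L2) \<Rightarrow> L2 \<Rightarrow> L2" where
  "adj T = (THE S. \<forall>f g. ip (T f) g = ip f (S g))"

definition Re_op :: "(L2 \<Rightarrow> L2) \<Rightarrow> L2 \<Rightarrow> L2" where
  "Re_op T = (\<lambda>f. cscale (1 / 2) (T f + adj T f))"

end

theory Submission
  imports Defs
begin

text \<open>Hypothesis (ii) says that the unitary operator \<open>U = (M\<^sub>z C J M\<^sub>z\<^sup>*)\<^sup>* C J\<close>
  has real part \<open>I\<close>; as \<open>\<parallel>U f - f\<parallel>\<^sup>2 = 2 \<parallel>f\<parallel>\<^sup>2 - 2 Re \<langle>U f, f\<rangle>\<close>, this forces \<open>U = I\<close>, that is,
  \<open>M\<^sub>z C M\<^sub>z = C\<close>. So \<open>C J\<close> is an isometry commuting with the bilateral shift, hence multiplication by a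
  unimodular \<open>\<psi>\<close>, and \<open>C\<close> is the conjugation of \<open>\<gamma> = z \<psi>\<close>.

  Let \<open>a = \<integral>\<alpha>\<close>, so \<open>|a| < 1\<close>. The kernel function \<open>k = 1 - \<bar>a \<alpha>\<close> (with \<open>\<bar>a\<close> the conjugate of \<open>a\<close>) and
  its conjugate \<open>(\<alpha> - a) / z\<close> lie in the model space of \<open>\<alpha>\<close>. Applying \<open>C\<close> to the latter, and \<open>C\<close> followed by
  the conjugation of \<open>\<theta>\<close> to the former, gives \<open>X k \<in> H\<^sup>2\<close> for \<open>X = \<gamma> J \<alpha>\<close> and for
  \<open>X = \<theta> J \<gamma>\<close>. Iterating \<open>X = X k + \<bar>a \<alpha> X\<close> shows that the negative Fourier coefficients of \<open>X\<close> agree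
  with those of \<open>\<bar>a\<^sup>N \<alpha>\<^sup>N X\<close>, which tend to 0. Hence \<open>X\<close> is inner.\<close>

section \<open>The Hilbert space structure of \<open>L\<^sup>2\<close>\<close>

lemma measurable_cnj [measurable]: "f \<in> borel_measurable M \<Longrightarrow> (\<lambda>z. cnj (f z)) \<in> borel_measurable M"
  by (rule measurable_compose[OF _ borel_measurable_continuous_onI]) (auto intro!: continuous_intros)

lemma integrable_mult_cnj:
  assumes "square_integrable f" "square_integrable g"
  shows "integrable circle (\<lambda>z. f z * cnj (g z))"
proof -
  have [measurable]: "f \<in> borel_measurable circle" "g \<in> borel_measurable circle"
    using assms by (auto simp: square_integrable_def)
  have "integrable circle (\<lambda>z. (cmod (f z))\<^sup>2 + (cmod (g z))\<^sup>2)"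
    using assms by (auto simp: square_integrable_def)
  then show ?thesis
  proof (rule Bochner_Integration.integrable_bound)
    have "cmod (f z) * cmod (g z) \<le> (cmod (f z))\<^sup>2 + (cmod (g z))\<^sup>2" for z
      using sum_squares_ge_zero[of "cmod (f z) - cmod (g z)" 0]
      by (simp add: power2_eq_square algebra_simps) (smt (verit) mult_nonneg_nonneg norm_ge_zero)
    then show "AE z in circle. norm (f z * cnj (g z)) \<le> norm ((cmod (f z))\<^sup>2 + (cmod (g z))\<^sup>2)"
      by (auto simp: norm_mult)
  qed measurable
qed

lemma ip_add_left: "ip (f + g) h = ip f h + ip g h"
  by transfer (simp add: distrib_right integrable_mult_cnj)

lemma ip_cscale_left: "ip (cscale c f) h = c * ip f h"
  by transfer (simp add: mult.assoc integrable_mult_cnj)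

lemma cnj_ip: "cnj (ip f g) = ip g f"
proof (transfer, elim conjE)
  fix f g :: "complex \<Rightarrow> complex"
  have "cnj (LINT z|circle. f z * cnj (g z)) = (LINT z|circle. cnj (f z * cnj (g z)))"
    by (simp only: Bochner_Integration.integral_cnj)
  then show "cnj (LINT z|circle. f z * cnj (g z)) = (LINT z|circle. g z * cnj (f z))"
    by (simp add: mult.commute)
qed

lemma ip_self: "ip f f = of_real (Re (ip f f))" and ip_self_nonneg: "0 \<le> Re (ip f f)"
  and ip_self_eq_0: "Re (ip f f) = 0 \<Longrightarrow> f = 0"
proof -
  show "ip f f = of_real (Re (ip f f))"
    using cnj_ip[of f f] by (simp add: complex_eq_iff)
  have *: "(LINT z|circle. f z * cnj (f z)) = of_real (LINT z|circle. (cmod (f z))\<^sup>2)" for f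
    by (subst integral_complex_of_real[symmetric])
       (auto intro!: Bochner_Integration.integral_cong simp: complex_norm_square simp del: of_real_power)
  show "0 \<le> Re (ip f f)"
    by transfer (simp add: *)
  show "f = 0" if "Re (ip f f) = 0"
    using that
  proof (transfer, elim conjE)
    fix f assume f: "square_integrable f" and "Re (LINT z|circle. f z * cnj (f z)) = 0"
    then have "(LINT z|circle. (cmod (f z))\<^sup>2) = 0" by (simp add: *)
    then have "AE z in circle. (cmod (f z))\<^sup>2 = 0"
      using f by (subst integral_nonneg_eq_0_iff_AE[symmetric]) (auto simp: square_integrable_def)
    then show "square_integrable f \<and> square_integrable (\<lambda>_. 0) \<and> (AE z in circle. f z = 0)"
      using f by (auto simp: square_integrable_def)
  qed
qed

lemma cscale_add: "cscale c (f + g) = cscale c f + cscale c g"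
  by transfer (auto simp: distrib_left intro!: square_integrable_add square_integrable_scale)

lemma cscale_add_left: "cscale (c + d) f = cscale c f + cscale d f"
  by transfer (auto simp: distrib_right intro!: square_integrable_add square_integrable_scale)

lemma cscale_cscale [simp]: "cscale c (cscale d f) = cscale (c * d) f"
  by transfer (auto simp: mult.assoc intro!: square_integrable_scale)

lemma cscale_one [simp]: "cscale 1 f = f"
  by transfer auto

text \<open>The real part of \<open>ip\<close> makes \<open>L2\<close> a real inner product space,
  so that spans, closures, bounded linear maps and the real Cauchy-Schwarz inequality are at hand.
  Complex scalars stay with \<open>cscale\<close>.\<close>

instantiation L2 :: real_inner
begin

definition scaleR_L2 :: "real \<Rightarrow> L2 \<Rightarrow> L2" where "scaleR_L2 r f = cscale (of_real r) f"
definition inner_L2 :: "L2 \<Rightarrow> L2 \<Rightarrow> real" where "inner_L2 f g = Re (ip f g)"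
definition norm_L2 :: "L2 \<Rightarrow> real" where "norm_L2 f = sqrt (Re (ip f f))"
definition dist_L2 :: "L2 \<Rightarrow> L2 \<Rightarrow> real" where "dist_L2 f g = norm (f - g)"
definition sgn_L2 :: "L2 \<Rightarrow> L2" where "sgn_L2 f = scaleR (inverse (norm f)) f"
definition uniformity_L2 :: "(L2 \<times> L2) filter" where
  "uniformity_L2 = (INF e\<in>{0 <..}. principal {(x, y). dist x y < e})"
definition open_L2 :: "L2 set \<Rightarrow> bool" where
  "open_L2 U \<longleftrightarrow> (\<forall>x\<in>U. eventually (\<lambda>(x', y). x' = x \<longrightarrow> y \<in> U) uniformity)"

instance
proof
  fix x y z :: L2 and r s :: real and U :: "L2 set"
  show "r *\<^sub>R (x + y) = r *\<^sub>R x + r *\<^sub>R y" by (simp add: scaleR_L2_def cscale_add)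
  show "(r + s) *\<^sub>R x = r *\<^sub>R x + s *\<^sub>R x" by (simp add: scaleR_L2_def cscale_add_left)
  show "r *\<^sub>R s *\<^sub>R x = (r * s) *\<^sub>R x" by (simp add: scaleR_L2_def)
  show "1 *\<^sub>R x = x" by (simp add: scaleR_L2_def)
  show "inner x y = inner y x"
    using cnj_ip[of x y] by (simp add: inner_L2_def complex_eq_iff)
  show "inner (x + y) z = inner x z + inner y z" by (simp add: inner_L2_def ip_add_left)
  show "inner (r *\<^sub>R x) y = r * inner x y" by (simp add: inner_L2_def scaleR_L2_def ip_cscale_left)
  show "0 \<le> inner x x" by (simp add: inner_L2_def ip_self_nonneg)
  show "(inner x x = 0) = (x = 0)"
    using ip_self_eq_0[of x] ip_cscale_left[of 0 0 0] by (auto simp: inner_L2_def, transfer, simp)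
  show "norm x = sqrt (inner x x)" by (simp add: norm_L2_def inner_L2_def)
  show "sgn x = scaleR (inverse (norm x)) x" by (simp add: sgn_L2_def)
  show "dist x y = norm (x - y)" by (simp add: dist_L2_def)
  show "(uniformity :: (L2 \<times> L2) filter) = (INF e\<in>{0 <..}. principal {(x, y). dist x y < e})"
    by (simp add: uniformity_L2_def)
  show "open U = (\<forall>x\<in>U. \<forall>\<^sub>F (x', y) in uniformity. x' = x \<longrightarrow> y \<in> U)"
    by (simp add: open_L2_def)
qed

end

lemma ip_norm: "ip f f = of_real ((norm f)\<^sup>2)"
  using ip_self[of f] ip_self_nonneg[of f] by (simp add: norm_L2_def)

lemma ip_zero_left [simp]: "ip 0 g = 0"
  by transfer simp

lemma ip_uminus_left: "ip (- f) g = - ip f g"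
  using ip_add_left[of f "- f" g] by (simp add: eq_neg_iff_add_eq_0 add.commute)

lemma ip_diff_left: "ip (f - g) h = ip f h - ip g h"
  using ip_add_left[of f "- g" h] by (simp add: ip_uminus_left)

lemma ip_diff_right: "ip h (f - g) = ip h f - ip h g"
  by (metis cnj_ip ip_diff_left complex_cnj_diff)

lemma ip_cscale_right: "ip h (cscale c f) = cnj c * ip h f"
  by (metis cnj_ip ip_cscale_left complex_cnj_mult)

lemma norm_cscale: "norm (cscale c f) = cmod c * norm f"
proof -
  have "complex_of_real ((norm (cscale c f))\<^sup>2) = of_real ((cmod c * norm f)\<^sup>2)"
    unfolding ip_norm[symmetric] ip_cscale_left ip_cscale_right
    by (simp add: ip_norm power_mult_distrib mult.assoc[symmetric] complex_norm_square mult.commute del: of_real_power)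
  then show ?thesis
    by (metis norm_ge_zero of_real_eq_iff power2_eq_imp_eq mult_nonneg_nonneg)
qed

text \<open>Rotating \<open>f\<close> by the unimodular \<open>c\<close> makes the product real and
  nonnegative; the real Cauchy-Schwarz inequality then applies.\<close>

lemma norm_ip_le: "cmod (ip f g) \<le> norm f * norm g"
proof (cases "ip f g = 0")
  case False
  define c where "c = cnj (sgn (ip f g))"
  have c: "cmod c = 1" using False by (simp add: c_def norm_sgn)
  have "c * ip f g = of_real (cmod (ip f g))"
    using False complex_norm_square[of "ip f g"]
    by (simp add: c_def sgn_eq power2_eq_square field_simps)
  then have "cmod (ip f g) = inner (cscale c f) g"
    by (simp add: inner_L2_def ip_cscale_left)
  also have "\<dots> \<le> norm (cscale c f) * norm g" by (rule norm_cauchy_schwarz)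
  finally show ?thesis by (simp add: norm_cscale c)
qed simp

lemma ip_eqI: "f = g" if "\<And>h. ip f h = ip g h"
  using that[of "f - g"] ip_norm[of "f - g"] by (simp add: ip_diff_left)

section \<open>Density of the trigonometric polynomials\<close>

lemma abs_L2_eqI:
  "square_integrable f \<Longrightarrow> square_integrable g \<Longrightarrow> AE z in circle. f z = g z \<Longrightarrow> abs_L2 f = abs_L2 g"
  by (rule Quotient_rel_abs[OF Quotient_L2]) simp

lemma abs_L2_add:
  "square_integrable f \<Longrightarrow> square_integrable g \<Longrightarrow> abs_L2 (\<lambda>z. f z + g z) = abs_L2 f + abs_L2 g"
  by (simp add: plus_L2.abs_eq)

lemma abs_L2_scale: "square_integrable f \<Longrightarrow> abs_L2 (\<lambda>z. c * f z) = cscale c (abs_L2 f)"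
  by (simp add: cscale.abs_eq)

lemma abs_L2_diff:
  assumes "square_integrable f" "square_integrable g"
  shows "abs_L2 (\<lambda>z. f z - g z) = abs_L2 f - abs_L2 g"
proof -
  have "square_integrable (\<lambda>z. - g z)" 
    using square_integrable_scale[OF assms(2), of "- 1"] by simp
  then show ?thesis
    using assms abs_L2_add[of f "\<lambda>z. - g z"] by (simp add: uminus_L2.abs_eq minus_L2_def)
qed

lemma norm_abs_L2:
  assumes "square_integrable f"
  shows "(norm (abs_L2 f))\<^sup>2 = (LINT z|circle. (cmod (f z))\<^sup>2)"
proof -
  have "complex_of_real ((norm (abs_L2 f))\<^sup>2) = (LINT z|circle. f z * cnj (f z))"
    unfolding ip_norm[symmetric] using assms by (simp add: ip.abs_eq)
  also have "\<dots> = of_real (LINT z|circle. (cmod (f z))\<^sup>2)"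
    by (subst integral_complex_of_real[symmetric])
       (auto intro!: Bochner_Integration.integral_cong simp: complex_norm_square simp del: of_real_power)
  finally show ?thesis by (simp only: of_real_eq_iff)
qed

lemma L2_cases: obtains f where "square_integrable f" "x = abs_L2 f"
  using Quotient_rep_reflp[OF Quotient_L2, of x] Quotient_abs_rep[OF Quotient_L2, of x] by metis

section \<open>Trigonometric polynomials and the functions they approximate\<close>

lemma monomial_abs: "monomial n = abs_L2 (\<lambda>z. z powi n)"
  by (simp add: monomial.abs_eq)

text \<open>\<open>span\<close> allows real coefficients only, so each generator enters with all its
  complex multiples.\<close>

definition trig_polys :: "L2 set" where
  "trig_polys = span (\<Union>n. range (\<lambda>c. cscale c (monomial n)))"

lemma closure_subspace_add:
  fixes S :: "'a::real_normed_vector set"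
  assumes S: "subspace S" and x: "x \<in> closure S" and y: "y \<in> closure S"
  shows "x + y \<in> closure S"
  unfolding closure_approachable
proof (intro allI impI)
  fix e :: real assume "e > 0"
  then have "e / 2 > 0" by simp
  then obtain a b where ab: "a \<in> S" "dist a x < e / 2" "b \<in> S" "dist b y < e / 2"
    using x y unfolding closure_approachable by meson
  have "dist (a + b) (x + y) < e"
    using ab(2,4) dist_triangle_add[of a b x y] by linarith
  then show "\<exists>y'\<in>S. dist y' (x + y) < e"
    using ab S subspace_add by blast
qed

lemma bounded_linear_cscale: "bounded_linear (cscale c)"
proof (rule bounded_linear_intro[where K = "cmod c"])
  show "cscale c (r *\<^sub>R x) = r *\<^sub>R cscale c x" for r x
    by (simp add: scaleR_L2_def mult.commute)
qed (auto simp: cscale_add norm_cscale mult.commute)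

lemma cscale_trig_polys: "f \<in> trig_polys \<Longrightarrow> cscale c f \<in> trig_polys"
proof -
  have "cscale c ` trig_polys = span (cscale c ` (\<Union>n. range (\<lambda>c. cscale c (monomial n))))"
    unfolding trig_polys_def
    by (rule linear_span_image[symmetric]) (rule bounded_linear.linear[OF bounded_linear_cscale])
  also have "\<dots> \<subseteq> trig_polys"
    unfolding trig_polys_def by (rule span_mono) auto
  finally show "f \<in> trig_polys \<Longrightarrow> cscale c f \<in> trig_polys" by blast
qed

text \<open>Stated for representatives, since the density argument works with pointwise limits and
  indicator functions.\<close>

definition trig_approximable :: "(complex \<Rightarrow> complex) \<Rightarrow> bool" where
  "trig_approximable f \<longleftrightarrow> square_integrable f \<and> abs_L2 f \<in> closure trig_polys"

lemma trig_approximable_add: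
  assumes "trig_approximable f" "trig_approximable g"
  shows "trig_approximable (\<lambda>z. f z + g z)"
  using assms by (auto simp: trig_approximable_def square_integrable_add abs_L2_add trig_polys_def
      intro!: closure_subspace_add)

lemma trig_approximable_scale:
  assumes "trig_approximable f"
  shows "trig_approximable (\<lambda>z. c * f z)"
proof -
  have "cscale c ` closure trig_polys \<subseteq> closure (cscale c ` trig_polys)"
    by (rule closure_bounded_linear_image_subset[OF bounded_linear_cscale])
  also have "\<dots> \<subseteq> closure trig_polys"
    by (rule closure_mono) (auto intro: cscale_trig_polys)
  finally show ?thesis
    using assms by (auto simp: trig_approximable_def square_integrable_scale abs_L2_scale)
qed

lemma trig_approximable_sum:
  assumes "\<And>i. i \<in> A \<Longrightarrow> trig_approximable (f i)" "finite A"
  shows "trig_approximable (\<lambda>z. \<Sum>i\<in>A. f i z)"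
  using assms(2,1)
proof (induction A rule: finite_induct)
  case empty
  have "square_integrable (\<lambda>z. 0)" by (simp add: square_integrable_def)
  moreover have "abs_L2 (\<lambda>z. 0) = 0" by (simp add: zero_L2_def)
  ultimately show ?case
    using closure_subset[of trig_polys] by (auto simp: trig_approximable_def trig_polys_def span_zero)
qed (auto intro: trig_approximable_add)

text \<open>Dominated convergence: \<open>4 * (w z)\<^sup>2\<close> dominates the squared distance
  of \<open>s i z\<close> and \<open>f z\<close>, so the convergence holds in norm and the limit
  stays in the closure.\<close>

lemma trig_approximable_limit:
  assumes s: "\<And>i::nat. trig_approximable (s i)" and f[measurable]: "f \<in> borel_measurable borel"
    and lim: "AE z in circle. (\<lambda>i. s i z) \<longlonglongrightarrow> f z"
    and w: "integrable circle (\<lambda>z. (w z)\<^sup>2)" and bound: "\<And>i. AE z in circle. cmod (s i z) \<le> w z"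
  shows "trig_approximable f"
proof -
  have sq: "square_integrable (s i)" for i using s by (simp add: trig_approximable_def)
  then have [measurable]: "s i \<in> borel_measurable circle" for i by (simp add: square_integrable_def)
  have f'[measurable]: "f \<in> borel_measurable circle" using f by (simp cong: measurable_cong_sets)
  have all: "AE z in circle. \<forall>i. cmod (s i z) \<le> w z"
    using bound by (simp add: AE_all_countable)
  have fw: "AE z in circle. cmod (f z) \<le> w z"
    using lim all
  proof eventually_elim
    case (elim z)
    then show ?case by (intro LIMSEQ_le_const2[OF tendsto_norm]) auto
  qed
  have "integrable circle (\<lambda>z. (cmod (f z))\<^sup>2)"
    using w
  proof (rule Bochner_Integration.integrable_bound)
    show "AE z in circle. norm ((cmod (f z))\<^sup>2) \<le> norm ((w z)\<^sup>2)"
      using fw by eventually_elim (simp add: power_mono)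
  qed measurable
  then have sqf: "square_integrable f" by (simp add: square_integrable_def)
  have "(\<lambda>i. LINT z|circle. (cmod (s i z - f z))\<^sup>2) \<longlonglongrightarrow> (LINT z|circle. 0)"
  proof (rule integral_dominated_convergence)
    show "integrable circle (\<lambda>z. 4 * (w z)\<^sup>2)" using w by simp
    show "AE z in circle. (\<lambda>i. (cmod (s i z - f z))\<^sup>2) \<longlonglongrightarrow> 0"
      using lim
    proof eventually_elim
      case (elim z)
      then have "(\<lambda>i. (cmod (s i z - f z))\<^sup>2) \<longlonglongrightarrow> (cmod (f z - f z))\<^sup>2"
        by (intro tendsto_intros)
      then show ?case by simp
    qed
    show "AE z in circle. norm ((cmod (s i z - f z))\<^sup>2) \<le> 4 * (w z)\<^sup>2" for i
      using all fw
    proof eventually_elim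
      case (elim z)
      then have "cmod (s i z - f z) \<le> 2 * w z"
        using norm_triangle_ineq4[of "s i z" "f z"] by (smt (verit))
      then have "(cmod (s i z - f z))\<^sup>2 \<le> (2 * w z)\<^sup>2" by (intro power_mono) auto
      then show ?case by (simp add: power_mult_distrib)
    qed
  qed measurable
  moreover have "(LINT z|circle. (cmod (s i z - f z))\<^sup>2) = (norm (abs_L2 (s i) - abs_L2 f))\<^sup>2" for i
  proof -
    have "square_integrable (\<lambda>z. s i z - f z)"
      using square_integrable_add[OF sq square_integrable_scale[OF sqf, of "- 1"]] by simp
    then show ?thesis by (simp add: norm_abs_L2 sq sqf flip: abs_L2_diff)
  qed
  ultimately have "(\<lambda>i. (norm (abs_L2 (s i) - abs_L2 f))\<^sup>2) \<longlonglongrightarrow> 0" by simp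
  then have "(\<lambda>i. sqrt ((norm (abs_L2 (s i) - abs_L2 f))\<^sup>2)) \<longlonglongrightarrow> sqrt 0"
    by (rule tendsto_real_sqrt)
  then have "(\<lambda>i. norm (abs_L2 (s i) - abs_L2 f)) \<longlonglongrightarrow> 0" by simp
  then have "(\<lambda>i. abs_L2 (s i)) \<longlonglongrightarrow> abs_L2 f"
    by (simp add: Lim_null[of _ "abs_L2 f"] tendsto_norm_zero_iff)
  then have "abs_L2 f \<in> closure trig_polys"
    by (rule closed_sequentially[OF closed_closure, rotated]) (use s in \<open>auto simp: trig_approximable_def\<close>)
  with sqf show ?thesis by (simp add: trig_approximable_def)
qed

text \<open>The equations are demanded on the unit circle only: it is there that
  \<open>Re (c * z)\<close> is a combination of \<open>z\<close> and its inverse.\<close>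

inductive trig_fun :: "(complex \<Rightarrow> complex) \<Rightarrow> bool" where
  mono: "(\<And>z. cmod z = 1 \<Longrightarrow> f z = c * z powi n) \<Longrightarrow> trig_fun f"
| add: "trig_fun f \<Longrightarrow> trig_fun g \<Longrightarrow> (\<And>z. cmod z = 1 \<Longrightarrow> h z = f z + g z) \<Longrightarrow> trig_fun h"

lemma trig_fun_mult:
  assumes "trig_fun f" "trig_fun g" "\<And>z. cmod z = 1 \<Longrightarrow> h z = f z * g z"
  shows "trig_fun h"
  using assms
proof (induction f arbitrary: h rule: trig_fun.induct)
  case (mono f c n)
  show ?case using mono(2,1,3)
  proof (induction g arbitrary: h rule: trig_fun.induct)
    case (mono g d m)
    show ?case
    proof (rule trig_fun.mono[where c = "c * d" and n = "n + m"])
      fix z :: complex assume z: "cmod z = 1"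
      then have "z \<noteq> 0" by auto
      then show "h z = c * d * z powi (n + m)"
        using z mono by (simp add: power_int_add)
    qed
  next
    case (add g1 g2 g)
    show ?case
      by (rule trig_fun.add[of "\<lambda>z. f z * g1 z" "\<lambda>z. f z * g2 z"])
         (use add in \<open>auto simp: distrib_left\<close>)
  qed
next
  case (add f1 f2 f)
  show ?case
    by (rule trig_fun.add[of "\<lambda>z. f1 z * g z" "\<lambda>z. f2 z * g z"])
       (use add in \<open>auto simp: distrib_right\<close>)
qed

text \<open>On the unit circle, which carries the measure, \<open>f\<close> agrees with a true
  combination of monomials. Off the circle \<open>f\<close> is arbitrary, hence the separate
  hypothesis that it is square-integrable.\<close>

lemma trig_fun_approximable:
  assumes "trig_fun f" "square_integrable f"
  shows "trig_approximable f"
proof -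
  have "\<exists>g. trig_approximable g \<and> (\<forall>z. cmod z = 1 \<longrightarrow> f z = g z)"
    using assms(1)
  proof (induction rule: trig_fun.induct)
    case (mono f c n)
    have "cscale 1 (monomial n) \<in> trig_polys"
      unfolding trig_polys_def by (rule span_base) blast
    then have "abs_L2 (\<lambda>z. z powi n) \<in> trig_polys"
      by (simp add: monomial_abs)
    then have "trig_approximable (\<lambda>z. z powi n)"
      using closure_subset[of trig_polys]
      by (simp add: trig_approximable_def square_integrable_powi subset_iff)
    then show ?case
      using mono by (intro exI[of _ "\<lambda>z. c * z powi n"]) (auto intro: trig_approximable_scale)
  next
    case (add f g h)
    then obtain f' g' where fg: "trig_approximable f'" "trig_approximable g'"
        "\<And>z. cmod z = 1 \<Longrightarrow> f z = f' z" "\<And>z. cmod z = 1 \<Longrightarrow> g z = g' z"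
      by blast
    show ?case
      by (rule exI[of _ "\<lambda>z. f' z + g' z"]) (use fg add in \<open>auto intro: trig_approximable_add\<close>)
  qed
  then obtain g where g: "trig_approximable g" "\<And>z. cmod z = 1 \<Longrightarrow> f z = g z" by blast
  have "AE z in circle. f z = g z"
    using AE_circle_norm by eventually_elim (rule g)
  then have "abs_L2 f = abs_L2 g"
    using assms(2) g(1) by (intro abs_L2_eqI) (auto simp: trig_approximable_def)
  with g assms(2) show ?thesis by (simp add: trig_approximable_def)
qed

text \<open>Stone-Weierstrass on the unit circle for the algebra \<open>P\<close> of continuous real
  functions that are trigonometric there; dominated convergence turns the uniform approximation into
  one in \<open>L2\<close>.\<close>

lemma trig_approximable_continuous:
  fixes f :: "complex \<Rightarrow> real"
  assumes f: "continuous_on UNIV f"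
  shows "trig_approximable (\<lambda>z. of_real (f z))"
proof -
  define P where "P g \<longleftrightarrow> continuous_on UNIV g \<and> trig_fun (\<lambda>z. of_real (g z))" for g :: "complex \<Rightarrow> real"
  \<comment> \<open>On the circle the inverse of \<open>z\<close> is its conjugate, so the real part
    of \<open>c * z\<close> is half the sum of \<open>c * z\<close> and
    \<open>cnj c * inverse z\<close>.\<close>
  have P_half: "trig_fun (\<lambda>z. of_real (Re (c * z)))" for c
  proof (rule trig_fun.add[of "\<lambda>z. c / 2 * z powi 1" "\<lambda>z. cnj c / 2 * z powi (- 1)"])
    show "of_real (Re (c * z)) = c / 2 * z powi 1 + cnj c / 2 * z powi - 1" if "cmod z = 1" for z
    proof -
      have "inverse z = cnj z"
        using that complex_norm_square[of z] by (intro inverse_unique) simp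
      then show ?thesis by (simp add: complex_eq_iff add_divide_distrib diff_divide_distrib)
    qed
  qed (rule trig_fun.mono, rule refl)+
  have lin: "P (\<lambda>z. Re (c * z))" for c
    using P_half by (auto simp: P_def intro!: continuous_intros)
  have "\<exists>g. P g \<and> (\<forall>z\<in>sphere 0 1. \<bar>f z - g z\<bar> < inverse (real (Suc n)))" for n
  proof (rule Stone_Weierstrass_HOL)
    show "P (\<lambda>x. c)" for c
      unfolding P_def by (auto intro!: trig_fun.mono[where c = "of_real c" and n = 0])
    show "P (\<lambda>x. g x + h x)" if "P g \<and> P h" for g h
      unfolding P_def
    proof (intro conjI)
      show "trig_fun (\<lambda>z. of_real (g z + h z))"
        by (rule trig_fun.add[of "\<lambda>z. of_real (g z)" "\<lambda>z. of_real (h z)"]) (use that in \<open>auto simp: P_def\<close>)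
    qed (use that in \<open>auto simp: P_def intro!: continuous_intros\<close>)
    show "P (\<lambda>x. g x * h x)" if "P g \<and> P h" for g h
      unfolding P_def
    proof (intro conjI)
      show "trig_fun (\<lambda>z. of_real (g z * h z))"
        by (rule trig_fun_mult[of "\<lambda>z. of_real (g z)" "\<lambda>z. of_real (h z)"]) (use that in \<open>auto simp: P_def\<close>)
    qed (use that in \<open>auto simp: P_def intro!: continuous_intros\<close>)
    \<comment> \<open>The real part (\<open>c = 1\<close>) and the imaginary part
      (\<open>c = - \<i>\<close>) separate points.\<close>
    show "\<exists>f. P f \<and> f x \<noteq> f y" if "x \<in> sphere 0 1 \<and> y \<in> sphere 0 1 \<and> x \<noteq> y" for x y
      using that lin[of 1] lin[of "- \<i>"] by (auto simp: complex_eq_iff)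
  qed (use f in \<open>auto simp: P_def intro: continuous_on_subset\<close>)
  then obtain g where g: "\<And>n. P (g n)"
      "\<And>n z. z \<in> sphere 0 1 \<Longrightarrow> \<bar>f z - g n z\<bar> < inverse (real (Suc n))"
    by metis
  have "compact (f ` sphere 0 1)"
    using f by (intro compact_continuous_image) (auto intro: continuous_on_subset)
  then obtain B where B: "\<And>z. z \<in> sphere 0 1 \<Longrightarrow> \<bar>f z\<bar> \<le> B"
    using compact_imp_bounded bounded_iff by (metis image_eqI real_norm_def)
  \<comment> \<open>The approximation errors are at most 1, so \<open>B + 1\<close> dominates every
    \<open>g n\<close> on the circle.\<close>
  have bd: "\<bar>g n z\<bar> \<le> B + 1" if "z \<in> sphere 0 1" for n z
  proof -
    have "inverse (real (Suc n)) \<le> 1" by (simp add: inverse_eq_divide)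
    then show ?thesis using g(2)[OF that, of n] B[OF that] by linarith
  qed
  have bdAE: "AE z in circle. cmod (of_real (g n z)) \<le> B + 1" for n
    using AE_circle_norm by eventually_elim (use bd in auto)
  show ?thesis
  proof (rule trig_approximable_limit[where s = "\<lambda>n z. of_real (g n z)" and w = "\<lambda>_. B + 1"])
    show "trig_approximable (\<lambda>z. of_real (g n z))" for n
    proof (rule trig_fun_approximable)
      show "square_integrable (\<lambda>z. of_real (g n z))"
        using g(1)[of n] bdAE[of n]
        by (intro square_integrableI_bounded[where B = "B + 1"])
           (auto simp: P_def intro!: borel_measurable_continuous_onI continuous_intros)
    qed (use g in \<open>auto simp: P_def\<close>)
    show "(\<lambda>z. complex_of_real (f z)) \<in> borel_measurable borel"
      using f by (intro borel_measurable_continuous_onI continuous_intros)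
    show "AE z in circle. (\<lambda>n. complex_of_real (g n z)) \<longlonglongrightarrow> of_real (f z)"
      using AE_circle_norm
    proof eventually_elim
      case (elim z)
      have "(\<lambda>n. g n z - f z) \<longlonglongrightarrow> 0"
      proof (rule Lim_null_comparison[OF _ LIMSEQ_inverse_real_of_nat])
        show "\<forall>\<^sub>F n in sequentially. norm (g n z - f z) \<le> inverse (real (Suc n))"
          using g(2)[of z] elim by (auto simp: abs_minus_commute intro!: always_eventually less_imp_le)
      qed
      then show ?case by (simp add: Lim_null[of _ "f z"] tendsto_of_real_iff)
    qed
    interpret prob_space circle by (rule prob_space_circle)
    show "integrable circle (\<lambda>z. (B + 1)\<^sup>2)" by simp
  qed (use bdAE in auto)
qed

text \<open>Dynkin's argument: the closed sets generate the Borel sets and are stable under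
  intersection, and the sets with approximable indicator are stable under complements and countable
  disjoint unions.\<close>

lemma trig_approximable_indicator:
  assumes "A \<in> sets borel"
  shows "trig_approximable (indicator A)"
proof -
  interpret prob_space circle by (rule prob_space_circle)
  have one: "trig_approximable (\<lambda>z. 1)"
    using trig_approximable_continuous[of "\<lambda>_. 1"] by simp
  have "Int_stable (Collect closed :: complex set set)" "Collect closed \<subseteq> Pow (UNIV :: complex set)"
      "A \<in> sigma_sets UNIV (Collect closed)"
    using assms by (auto simp: Int_stable_def borel_eq_closed)
  then show ?thesis
  proof (induction rule: sigma_sets_induct_disjoint)
    case (basic F)
    then have F: "closed F" by simp
    \<comment> \<open>\<open>infdist\<close> to the empty set is 0 by convention, so the functions
      \<open>s n\<close> below would be constantly 1 for \<open>F = {}\<close>.\<close>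
    show ?case
    proof (cases "F = {}")
      case True
      then show ?thesis using trig_approximable_scale[OF one, of 0] by simp
    next
      case ne: False
      \<comment> \<open>Continuous functions equal to 1 on \<open>F\<close> that, for
        \<open>n > 0\<close>, vanish at distance at least \<open>1 / n\<close> from it; as
        \<open>F\<close> is closed, they tend to its indicator.\<close>
      define s where "s n z = max 0 (1 - real n * infdist z F)" for n z
      show ?thesis
      proof (rule trig_approximable_limit[where s = "\<lambda>n z. of_real (s n z)" and w = "\<lambda>_. 1"])
        show "trig_approximable (\<lambda>z. of_real (s n z))" for n
          unfolding s_def by (intro trig_approximable_continuous continuous_intros)
        show "AE z in circle. (\<lambda>n. complex_of_real (s n z)) \<longlonglongrightarrow> indicator F z"
        proof (rule AE_I2)
          fix z
          show "(\<lambda>n. complex_of_real (s n z)) \<longlonglongrightarrow> indicator F z"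
          proof (cases "z \<in> F")
            case True
            then show ?thesis by (simp add: s_def)
          next
            case False
            then have pos: "infdist z F > 0"
              using infdist_pos_not_in_closed[OF F ne] by simp
            obtain N :: nat where N: "1 / infdist z F < N" using reals_Archimedean2 by blast
            have "s n z = 0" if "n \<ge> N" for n
            proof -
              have "1 < real N * infdist z F" using N pos by (simp add: field_simps)
              also have "\<dots> \<le> real n * infdist z F" using that pos by (intro mult_right_mono) auto
              finally show ?thesis by (simp add: s_def)
            qed
            then have "\<forall>\<^sub>F n in sequentially. complex_of_real (s n z) = 0"
              by (auto simp: eventually_sequentially)
            then show ?thesis using False by (simp add: tendsto_eventually)
          qed
        qed
        show "AE z in circle. cmod (complex_of_real (s n z)) \<le> 1" for n
          by (auto simp: s_def infdist_nonneg)
      qed (use F in auto)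
    qed
  next
    case empty
    then show ?case using trig_approximable_scale[OF one, of 0] by simp
  next
    case (compl A)
    have "trig_approximable (\<lambda>z. 1 + - 1 * indicator A z)"
      by (intro trig_approximable_add trig_approximable_scale one compl)
    also have "(\<lambda>z. 1 + - 1 * indicator A z :: complex) = indicator (UNIV - A)"
      by (auto simp: indicator_def)
    finally show ?case .
  next
    case (union A)
    show ?case
    proof (rule trig_approximable_limit[where s = "\<lambda>n. indicator (\<Union>i<n. A i)" and w = "\<lambda>_. 1"])
      show "trig_approximable (indicator (\<Union>i<n. A i))" for n
      proof -
        have "disjoint_family_on A {..<n}"
          using union(1) by (rule disjoint_family_on_mono[rotated]) simp
        then have "indicator (\<Union>i<n. A i) = (\<lambda>z. \<Sum>i<n. indicator (A i) z :: complex)"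
          by (simp add: indicator_UN_disjoint fun_eq_iff)
        then show ?thesis using union by (auto intro: trig_approximable_sum)
      qed
      have "A i \<in> sets borel" for i using union(2) by (auto simp: borel_eq_closed)
      then show "(indicator (\<Union>i. A i) :: complex \<Rightarrow> complex) \<in> borel_measurable borel" by measurable
      show "AE z in circle. (\<lambda>n. indicator (\<Union>i<n. A i) z :: complex) \<longlonglongrightarrow> indicator (\<Union>i. A i) z"
        by (intro AE_I2 LIMSEQ_indicator_UN)
      show "AE z in circle. cmod (indicator (\<Union>i<n. A i) z) \<le> 1" for n
        by (intro AE_I2) (simp add: indicator_def)
    qed auto
  qed
qed

text \<open>A square-integrable function is a pointwise limit of simple functions dominated by twice
  its modulus, and simple functions are combinations of indicators.\<close>

lemma trig_polys_dense: "closure trig_polys = UNIV"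
proof (intro set_eqI iffI UNIV_I)
  fix x :: L2
  obtain f where f: "square_integrable f" "x = abs_L2 f" by (rule L2_cases)
  have [measurable]: "f \<in> borel_measurable borel"
    using f(1) by (simp add: square_integrable_def cong: measurable_cong_sets)
  obtain s where s: "\<And>i. simple_function borel (s i)" "\<And>z. (\<lambda>i. s i z) \<longlonglongrightarrow> f z"
      "\<And>i z. cmod (s i z) \<le> 2 * cmod (f z)"
    using borel_measurable_implies_sequence_metric[of f borel 0] by (auto simp: dist_norm)
  have "trig_approximable f"
  proof (rule trig_approximable_limit[where s = s and w = "\<lambda>z. 2 * cmod (f z)"])
    show "trig_approximable (s i)" for i
    proof -
      have fin: "finite (s i ` UNIV)" and meas: "\<And>y. s i -` {y} \<in> sets borel"
        using simple_functionD(1)[OF s(1)] simple_functionD(2)[OF s(1), of i "{_}"] by auto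
      have "trig_approximable (\<lambda>z. \<Sum>y\<in>s i ` UNIV. y * indicator (s i -` {y}) z)"
        by (intro trig_approximable_sum fin trig_approximable_scale trig_approximable_indicator meas)
      also have "(\<lambda>z. \<Sum>y\<in>s i ` UNIV. y * indicator (s i -` {y}) z) = s i"
      proof
        fix z
        have "(\<Sum>y\<in>s i ` UNIV. y * indicator (s i -` {y}) z) = (\<Sum>y\<in>s i ` UNIV. if y = s i z then y else 0)"
          by (intro sum.cong) (auto simp: indicator_def)
        then show "(\<Sum>y\<in>s i ` UNIV. y * indicator (s i -` {y}) z) = s i z" using fin by simp
      qed
      finally show ?thesis .
    qed
    show "integrable circle (\<lambda>z. (2 * cmod (f z))\<^sup>2)"
      using f(1) by (simp add: square_integrable_def power_mult_distrib)
  qed (use s in auto)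
  then show "x \<in> closure trig_polys" by (simp add: trig_approximable_def f)
qed

section \<open>Multiplication operators and Fourier coefficients\<close>

lemma unimodular_Linfty: "unimodular p \<Longrightarrow> p \<in> Linfty"
  unfolding Linfty_def mem_Collect_eq by transfer (auto intro!: exI[of _ 1] elim: eventually_mono)

lemma unimodular_monomial [simp]: "unimodular (monomial n)"
  by transfer (use AE_circle_norm in \<open>auto simp: norm_power_int elim: eventually_mono\<close>)

lemma monomial_Linfty [simp]: "monomial n \<in> Linfty"
  by (simp add: unimodular_Linfty)

lemma Linfty_J [simp]: "p \<in> Linfty \<Longrightarrow> J p \<in> Linfty"
  unfolding Linfty_def mem_Collect_eq by transfer simp

lemma unimodular_J: "unimodular p \<Longrightarrow> unimodular (J p)"
  by transfer simp

lemma Mult_commute: "Mult p f = Mult f p"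
  by transfer (auto simp: mult.commute square_integrable_def)

lemma Linfty_Mult [simp]: "p \<in> Linfty \<Longrightarrow> q \<in> Linfty \<Longrightarrow> Mult p q \<in> Linfty"
  unfolding Linfty_def mem_Collect_eq
proof (transfer, elim conjE exE)
  fix p q :: "complex \<Rightarrow> complex" and A B :: real
  assume p: "square_integrable p" "AE z in circle. cmod (p z) \<le> A"
    and q: "square_integrable q" "AE z in circle. cmod (q z) \<le> B"
  have "AE z in circle. cmod (p z * q z) \<le> A * B"
    using p(2) q(2) by eventually_elim (auto simp: norm_mult intro!: mult_mono intro: order_trans[OF norm_ge_zero])
  then show "\<exists>B. AE z in circle. cmod ((if square_integrable (\<lambda>z. p z * q z) then \<lambda>z. p z * q z else (\<lambda>_. 0)) z) \<le> B"
    using p q square_integrable_mult[of p q] by auto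
qed

lemma unimodular_Mult: "unimodular p \<Longrightarrow> unimodular q \<Longrightarrow> unimodular (Mult p q)"
proof (transfer, elim conjE)
  fix p q :: "complex \<Rightarrow> complex"
  assume p: "square_integrable p" "AE z in circle. cmod (p z) = 1"
    and q: "square_integrable q" "AE z in circle. cmod (q z) = 1"
  have "AE z in circle. cmod (p z) \<le> 1" using p(2) by eventually_elim simp
  then have "square_integrable (\<lambda>z. p z * q z)" by (intro square_integrable_mult p(1) q(1) exI)
  moreover have "AE z in circle. cmod (p z * q z) = 1"
    using p(2) q(2) by eventually_elim (simp add: norm_mult)
  ultimately show "AE z in circle. cmod ((if square_integrable (\<lambda>z. p z * q z) then \<lambda>z. p z * q z else (\<lambda>_. 0)) z) = 1"
    by simp
qed

text \<open>Boundedness of the factors keeps all these products square-integrable, so that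
  \<open>Mult\<close> never falls back to its default value 0.\<close>

lemma Mult_assoc:
  assumes "p \<in> Linfty" "q \<in> Linfty"
  shows "Mult (Mult p q) f = Mult p (Mult q f)"
proof -
  have "Mult p q \<in> Linfty" using assms by simp
  with assms show ?thesis
    unfolding Linfty_def mem_Collect_eq
    by transfer (simp add: square_integrable_mult mult.assoc)
qed

lemma Mult_left_commute:
  "p \<in> Linfty \<Longrightarrow> q \<in> Linfty \<Longrightarrow> Mult p (Mult q f) = Mult q (Mult p f)"
  by (metis Mult_assoc Mult_commute)

lemma Mult_add: "p \<in> Linfty \<Longrightarrow> Mult p (f + g) = Mult p f + Mult p g"
  unfolding Linfty_def mem_Collect_eq
  by transfer (simp add: square_integrable_mult square_integrable_add distrib_left)

lemma Mult_diff: "p \<in> Linfty \<Longrightarrow> Mult p (f - g) = Mult p f - Mult p g"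
  using Mult_add[of p "f - g" g] by simp

lemma Mult_cscale: "p \<in> Linfty \<Longrightarrow> Mult p (cscale c f) = cscale c (Mult p f)"
  unfolding Linfty_def mem_Collect_eq
  by transfer (simp add: square_integrable_mult square_integrable_scale mult.left_commute)

lemma Mult_one [simp]: "Mult (monomial 0) f = f"
  by transfer auto

lemma Mult_one_right: "Mult f (monomial 0) = f"
  by (subst Mult_commute) simp

lemma AE_circle_nonzero: "AE z in circle. z \<noteq> 0"
  using AE_circle_norm by eventually_elim auto

lemma Mult_monomial: "Mult (monomial m) (monomial n) = monomial (m + n)"
proof transfer
  fix m n :: int
  have *: "AE z in circle. z powi m * z powi n = z powi (m + n)"
    using AE_circle_nonzero by eventually_elim (simp add: power_int_add)
  have "AE z::complex in circle. cmod (z powi m) \<le> 1"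
    using AE_circle_norm by eventually_elim (simp add: norm_power_int)
  then have "square_integrable (\<lambda>z. z powi m * z powi n)"
    by (intro square_integrable_mult square_integrable_powi exI)
  with * show "square_integrable (if square_integrable (\<lambda>z. z powi m * z powi n) then \<lambda>z. z powi m * z powi n else (\<lambda>_. 0)) \<and>
      square_integrable (\<lambda>z. z powi (m + n)) \<and>
      (AE z in circle. (if square_integrable (\<lambda>z. z powi m * z powi n) then \<lambda>z. z powi m * z powi n else (\<lambda>_. 0)) z = z powi (m + n))"
    by (simp add: square_integrable_powi)
qed

lemma Mult_monomial_left: "Mult (monomial m) (Mult (monomial n) f) = Mult (monomial (m + n)) f"
  by (simp add: Mult_monomial flip: Mult_assoc)

lemma J_J [simp]: "J (J f) = f"
  by transfer simp

lemma J_add: "J (f + g) = J f + J g"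
  by transfer (simp add: square_integrable_add square_integrable_cnj)

lemma J_diff: "J (f - g) = J f - J g"
  using J_add[of "f - g" g] by simp

lemma J_cscale: "J (cscale c f) = cscale (cnj c) (J f)"
  by transfer (simp add: square_integrable_scale square_integrable_cnj)

lemma J_monomial: "J (monomial n) = monomial (- n)"
proof transfer
  fix n
  have "AE z in circle. cnj (z powi n) = z powi - n"
    using AE_circle_norm
  proof eventually_elim
    case (elim z)
    have "cmod (z powi n) = 1" using elim by (simp add: norm_power_int)
    then have "inverse (z powi n) = cnj (z powi n)"
      using complex_norm_square[of "z powi n"] by (intro inverse_unique) simp
    then show ?case by (simp add: power_int_minus)
  qed
  then show "square_integrable (\<lambda>z. cnj (z powi n)) \<and> square_integrable (\<lambda>z. z powi - n) \<and>
      (AE z in circle. cnj (z powi n) = z powi - n)"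
    by (simp add: square_integrable_powi square_integrable_cnj del: complex_cnj_power_int)
qed

lemma square_integrable_cnj_iff: "square_integrable (\<lambda>z. cnj (f z)) = square_integrable f"
  using square_integrable_cnj[of f] square_integrable_cnj[of "\<lambda>z. cnj (f z)"] by auto

lemma J_Mult: "J (Mult p f) = Mult (J p) (J f)"
proof (transfer, elim conjE)
  fix p f :: "complex \<Rightarrow> complex"
  have "square_integrable (\<lambda>z. cnj (p z) * cnj (f z)) = square_integrable (\<lambda>z. p z * f z)"
    using square_integrable_cnj_iff[of "\<lambda>z. p z * f z"] by simp
  moreover have "square_integrable (\<lambda>_. 0)" by (simp add: square_integrable_def)
  ultimately show "square_integrable (\<lambda>z. cnj ((if square_integrable (\<lambda>z. p z * f z) then \<lambda>z. p z * f z else (\<lambda>_. 0)) z)) \<and>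
    square_integrable (if square_integrable (\<lambda>z. cnj (p z) * cnj (f z)) then \<lambda>z. cnj (p z) * cnj (f z) else (\<lambda>_. 0)) \<and>
    (AE z in circle. cnj ((if square_integrable (\<lambda>z. p z * f z) then \<lambda>z. p z * f z else (\<lambda>_. 0)) z) =
      (if square_integrable (\<lambda>z. cnj (p z) * cnj (f z)) then \<lambda>z. cnj (p z) * cnj (f z) else (\<lambda>_. 0)) z)"
    by auto
qed

lemma ip_J: "ip (J f) (J g) = ip g f"
  by transfer (simp add: mult.commute)

lemma ip_Mult: "p \<in> Linfty \<Longrightarrow> ip (Mult p f) g = ip f (Mult (J p) g)"
  unfolding Linfty_def mem_Collect_eq
proof (transfer, elim conjE)
  fix p f g :: "complex \<Rightarrow> complex"
  assume *: "square_integrable p" "square_integrable f" "square_integrable g"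
    "\<exists>B. AE z in circle. cmod (p z) \<le> B"
  then have "square_integrable (\<lambda>z. p z * f z)" "square_integrable (\<lambda>z. cnj (p z) * g z)"
    by (simp_all add: square_integrable_mult square_integrable_cnj)
  then show "(LINT z|circle. (if square_integrable (\<lambda>z. p z * f z) then \<lambda>z. p z * f z else (\<lambda>_. 0)) z * cnj (g z)) =
     (LINT z|circle. f z * cnj ((if square_integrable (\<lambda>z. cnj (p z) * g z) then \<lambda>z. cnj (p z) * g z else (\<lambda>_. 0)) z))"
    by (simp add: mult_ac)
qed

text \<open>Here \<open>f\<close> may be unbounded, so \<open>ip_Mult\<close> cannot move it across.
  Only the bounded \<open>g\<close> and \<open>h\<close> are moved, against the constant 1, and
  \<open>J\<close> turns the result around. This is applied to a symbol not yet known to be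
  bounded.\<close>

lemma ip_Mult_swap:
  assumes "h \<in> Linfty" "g \<in> Linfty"
  shows "ip (Mult h f) g = ip h (Mult (J f) g)"
proof -
  have "ip (Mult h f) g = ip (Mult (J g) (Mult h f)) (monomial 0)"
    using assms by (simp add: ip_Mult Mult_one_right)
  also have "\<dots> = ip (Mult h (Mult (J g) f)) (monomial 0)"
    using assms by (simp add: Mult_left_commute)
  also have "\<dots> = ip (Mult (J g) f) (J h)"
    using assms by (simp add: ip_Mult Mult_one_right)
  also have "\<dots> = ip h (J (Mult (J g) f))"
    using ip_J[of "J (Mult (J g) f)" h] by simp
  finally show ?thesis by (simp add: J_Mult Mult_commute)
qed

lemma unimodular_Mult_J:
  assumes "unimodular p"
  shows "Mult p (J p) = monomial 0"
  using assms
proof (transfer, elim conjE)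
  fix p :: "complex \<Rightarrow> complex"
  assume p: "square_integrable p" "AE z in circle. cmod (p z) = 1"
  have "AE z in circle. cmod (p z) \<le> 1" using p(2) by eventually_elim simp
  then have "square_integrable (\<lambda>z. p z * cnj (p z))"
    by (intro square_integrable_mult square_integrable_cnj p(1) exI)
  moreover have "AE z in circle. p z * cnj (p z) = 1"
    using p(2) by eventually_elim (simp flip: complex_norm_square)
  ultimately show "square_integrable (if square_integrable (\<lambda>z. p z * cnj (p z)) then \<lambda>z. p z * cnj (p z) else (\<lambda>_. 0)) \<and>
     square_integrable (\<lambda>z. z powi 0) \<and>
     (AE z in circle. (if square_integrable (\<lambda>z. p z * cnj (p z)) then \<lambda>z. p z * cnj (p z) else (\<lambda>_. 0)) z = z powi 0)"
    using square_integrable_powi[of 0] by simp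
qed

lemma unimodular_cancel:
  assumes "unimodular p"
  shows "Mult p (Mult (J p) f) = f" "Mult (J p) (Mult p f) = f"
proof -
  have *: "p \<in> Linfty" "J p \<in> Linfty" using assms by (auto simp: unimodular_Linfty)
  show "Mult p (Mult (J p) f) = f"
    by (simp add: * unimodular_Mult_J[OF assms] flip: Mult_assoc)
  then show "Mult (J p) (Mult p f) = f"
    by (simp add: * Mult_left_commute[of "J p"])
qed

lemma norm_eqI: "ip f f = ip g g \<Longrightarrow> norm f = norm g"
  by (simp add: norm_L2_def)

lemma norm_unimodular_Mult: "unimodular p \<Longrightarrow> norm (Mult p f) = norm f"
  by (rule norm_eqI) (simp add: ip_Mult unimodular_Linfty unimodular_cancel)

section \<open>Orthonormality of the monomials\<close>

lemma integral_circle: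
  fixes f :: "complex \<Rightarrow> complex"
  assumes [measurable]: "f \<in> borel_measurable borel"
  shows "(LINT z|circle. f z) = (LINT t|lborel. indicator {0..2*pi} t *\<^sub>R f (cis t)) /\<^sub>R (2 * pi)"
proof -
  have cis: "cis \<in> borel_measurable borel"
    by (intro borel_measurable_continuous_onI continuous_intros)
  note [measurable] = cis
  have dens: "uniform_measure lborel {0..<2*pi}
      = density lborel (\<lambda>t. ennreal (indicator {0..<2*pi} t / (2 * pi)))"
    unfolding uniform_measure_def
  proof (rule arg_cong[where f = "density lborel"], rule ext)
    fix t :: real
    have "1 / ennreal (2 * pi) = ennreal (1 / (2 * pi))"
      by (subst ennreal_1[symmetric], subst divide_ennreal) auto
    then show "indicator {0..<2*pi} t / emeasure lborel {0..<2*pi}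
        = ennreal (indicator {0..<2*pi} t / (2 * pi))"
      by (cases "t \<in> {0..<2*pi}") simp_all
  qed
  have "(LINT z|circle. f z) = (LINT t|uniform_measure lborel {0..<2*pi}. f (cis t))"
    unfolding circle_def by (rule integral_distr[OF cis_measurable assms])
  also have "\<dots> = (LINT t|lborel. (indicator {0..<2*pi} t / (2 * pi)) *\<^sub>R f (cis t))"
    unfolding dens by (rule integral_density) auto
  \<comment> \<open>The endpoint \<open>2 * pi\<close> is a null set; the fundamental theorem of
    calculus in \<open>integral_powi\<close> wants a closed interval.\<close>
  also have "\<dots> = (LINT t|lborel. (indicator {0..2*pi} t *\<^sub>R f (cis t)) /\<^sub>R (2 * pi))"
  proof (rule integral_cong_AE)
    have "AE t in lborel. t \<noteq> 2 * pi" by (rule AE_lborel_singleton)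
    then show "AE t in lborel. (indicator {0..<2*pi} t / (2 * pi)) *\<^sub>R f (cis t)
        = (indicator {0..2*pi} t *\<^sub>R f (cis t)) /\<^sub>R (2 * pi)"
    proof eventually_elim
      case (elim t)
      then have "indicator {0..<2*pi} t = (indicator {0..2*pi} t :: real)"
        by (auto simp: indicator_def)
      then show ?case by (simp only: scaleR_scaleR divide_inverse mult.commute)
    qed
  qed measurable
  also have "\<dots> = (LINT t|lborel. indicator {0..2*pi} t *\<^sub>R f (cis t)) /\<^sub>R (2 * pi)"
    by (rule integral_scaleR_right)
  finally show ?thesis .
qed

text \<open>The antiderivative \<open>cis (n * t) / (\<i> * n)\<close> takes the same value at
  \<open>0\<close> and at \<open>2 * pi\<close>.\<close>

lemma integral_powi:
  assumes "n \<noteq> 0"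
  shows "(LINT z|circle. z powi n) = 0"
proof -
  have "(\<lambda>z::complex. z powi n) \<in> borel_measurable borel"
    by (cases "n \<ge> 0") (simp_all add: power_int_def)
  then have "(LINT z|circle. z powi n) = (LINT t|lborel. indicator {0..2*pi} t *\<^sub>R cis t powi n) /\<^sub>R (2 * pi)"
    by (rule integral_circle)
  also have "(LINT t|lborel. indicator {0..2*pi} t *\<^sub>R cis t powi n)
      = cis (of_int n * (2 * pi)) / (\<i> * of_int n) - cis (of_int n * 0) / (\<i> * of_int n)"
  proof (rule integral_FTC_Icc)
    fix t :: real
    have "((\<lambda>t. cis (of_int n * t)) has_vector_derivative of_int n *\<^sub>R (\<i> * cis (of_int n * t))) (at t within {0..2*pi})"
      using exp_scaleR_has_vector_derivative_right[of "\<i> * of_int n" t "{0..2*pi}"]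
      by (simp add: cis_conv_exp scaleR_conv_of_real mult_ac)
    then have "((\<lambda>t. cis (of_int n * t) / (\<i> * of_int n)) has_vector_derivative
        (of_int n *\<^sub>R (\<i> * cis (of_int n * t))) / (\<i> * of_int n)) (at t within {0..2*pi})"
      by (rule has_vector_derivative_divide)
    moreover have "(of_int n *\<^sub>R (\<i> * cis (of_int n * t))) / (\<i> * of_int n) = cis t powi n"
      using assms by (simp add: cis_power_int scaleR_conv_of_real field_simps)
    ultimately show "((\<lambda>t. cis (of_int n * t) / (\<i> * of_int n)) has_vector_derivative cis t powi n)
        (at t within {0..2*pi})" by simp
  qed (auto intro!: continuous_intros simp: cis_power_int)
  also have "\<dots> = 0"
    using cis_multiple_2pi[of "of_int n"] by (simp add: mult.commute)
  finally show ?thesis by simp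
qed

lemma ip_monomial: "ip (monomial m) (monomial n) = (if m = n then 1 else 0)"
proof -
  interpret prob_space circle by (rule prob_space_circle)
  have 0: "ip (monomial k) (monomial 0) = (if k = 0 then 1 else 0)" for k
    by transfer (simp add: integral_powi prob_space[simplified])
  have "ip (monomial m) (monomial n) = ip (Mult (monomial (- n)) (monomial m)) (monomial 0)"
    using ip_Mult[of "monomial (- n)" "monomial m" "monomial 0"] by (simp add: J_monomial Mult_monomial)
  then show ?thesis by (simp add: Mult_monomial 0)
qed

lemma norm_unimodular: "unimodular p \<Longrightarrow> norm p = 1"
proof -
  assume "unimodular p"
  then have "norm p = norm (Mult p (monomial 0))"
    by (simp add: Mult_one_right)
  also have "\<dots> = norm (monomial 0)"
    by (rule norm_unimodular_Mult) fact
  also have "\<dots> = 1" by (simp add: norm_L2_def ip_monomial)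
  finally show ?thesis .
qed

section \<open>Consequences of density\<close>

lemma bounded_linear_ip_left: "bounded_linear (\<lambda>f. ip f g)"
  by (rule bounded_linear_intro[where K = "norm g"])
     (auto simp: ip_add_left scaleR_L2_def ip_cscale_left scaleR_conv_of_real norm_ip_le)

text \<open>The set of agreement is closed and contains the dense \<open>trig_polys\<close>.
  Linearity is over the reals, which is why the hypothesis carries the complex scalar
  \<open>c\<close>.\<close>

lemma bounded_linear_eq_on_monomials:
  fixes F G :: "L2 \<Rightarrow> 'b::real_normed_vector"
  assumes "bounded_linear F" "bounded_linear G"
    and eq: "\<And>c n. F (cscale c (monomial n)) = G (cscale c (monomial n))"
  shows "F x = G x"
proof -
  have "closed {x. F x = G x}"
    using assms(1,2)[THEN linear_continuous_on[of _ UNIV]] by (rule closed_Collect_eq)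
  moreover have "trig_polys \<subseteq> {x. F x = G x}"
    unfolding trig_polys_def
    using linear_eq_on_span[OF assms(1,2)[THEN bounded_linear.linear], of "\<Union>n. range (\<lambda>c. cscale c (monomial n))"] eq
    by blast
  ultimately show ?thesis
    using closure_minimal trig_polys_dense by blast
qed

lemma fourier_eqI:
  assumes "\<And>n. ip f (monomial n) = ip g (monomial n)"
  shows "f = g"
proof (rule ip_eqI)
  fix h
  have "ip h (f - g) = 0"
  proof (rule bounded_linear_eq_on_monomials[OF bounded_linear_ip_left bounded_linear_zero])
    fix c n
    have "ip (monomial n) (f - g) = cnj (ip (f - g) (monomial n))" by (simp add: cnj_ip)
    also have "\<dots> = 0" by (simp add: ip_diff_left assms)
    finally show "ip (cscale c (monomial n)) (f - g) = 0" by (simp add: ip_cscale_left)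
  qed
  then have "ip (f - g) h = 0" by (subst cnj_ip[symmetric]) simp
  then show "ip f h = ip g h" by (simp add: ip_diff_left)
qed

text \<open>An element of H^2 is a limit of analytic polynomials: if a trigonometric polynomial
  approximates \<open>h\<close>, its part with nonnegative frequencies does at least as
  well.\<close>

lemma Hardy2_orthogonal:
  assumes h: "h \<in> Hardy2" and w: "\<And>n. n \<ge> 0 \<Longrightarrow> ip (monomial n) w = 0"
  shows "ip h w = 0"
proof -
  define P where "P = (\<Union>n\<in>{0..}. range (\<lambda>c. cscale c (monomial n)))"
  define N where "N = (\<Union>n\<in>{..<0}. range (\<lambda>c. cscale c (monomial n)))"
  have ortho: "ip p q = 0" if "p \<in> span S" "\<And>s. s \<in> S \<Longrightarrow> ip s q = 0" for p q S
    using that(1)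
  proof (induction rule: span_induct_alt)
    case (step c x y)
    then show ?case by (simp add: ip_add_left scaleR_L2_def ip_cscale_left that(2))
  qed simp
  have "cmod (ip h w) \<le> e * norm w" if e: "e > 0" for e
  proof -
    have "h \<in> closure trig_polys" by (simp add: trig_polys_dense)
    then obtain p where p: "p \<in> trig_polys" "dist p h < e"
      using e by (auto simp: closure_approachable)
    have "{0::int..} \<union> {..<0} = UNIV" by auto
    moreover have "(\<Union>n\<in>{0..} \<union> {..<0}. range (\<lambda>c. cscale c (monomial n))) = P \<union> N"
      unfolding P_def N_def by (rule UN_Un)
    ultimately have "(\<Union>n. range (\<lambda>c. cscale c (monomial n))) = P \<union> N"
      by (simp only:)
    with p(1) have "p \<in> span (P \<union> N)" by (simp only: trig_polys_def)
    then obtain a b where ab: "p = a + b" "a \<in> span P" "b \<in> span N"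
      unfolding span_Un by blast
    have "ip s h = 0" if "s \<in> N" for s
    proof -
      from that obtain c n where s: "s = cscale c (monomial n)" "n < 0" by (auto simp: N_def)
      have "ip (monomial n) h = cnj (fourier h n)" by (simp add: fourier_def cnj_ip)
      then show ?thesis using h s by (simp add: Hardy2_def ip_cscale_left)
    qed
    then have "ip b h = 0" by (rule ortho[OF ab(3)])
    moreover have "ip b a = 0"
    proof (rule ortho[OF ab(3)])
      fix s assume "s \<in> N"
      then obtain c n where s: "s = cscale c (monomial n)" "n < 0" by (auto simp: N_def)
      have "ip a s = 0"
        by (rule ortho[OF ab(2)])
           (use s in \<open>auto simp: P_def ip_cscale_left ip_cscale_right ip_monomial\<close>)
      then show "ip s a = 0" by (subst cnj_ip[symmetric]) simp
    qed
    \<comment> \<open>By Pythagoras, dropping \<open>b\<close> from \<open>p = a + b\<close> does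
      not increase the distance to \<open>h\<close>.\<close>
    ultimately have "ip b (h - a) = 0" by (simp add: ip_diff_right)
    then have *: "inner b (h - a) = 0" by (simp add: inner_L2_def)
    have "(norm (x - b))\<^sup>2 = (norm x)\<^sup>2 + (norm b)\<^sup>2" if "inner b x = 0" for x
      using that inner_commute[of b x]
      by (simp add: power2_norm_eq_inner inner_diff_left inner_diff_right)
    from this[OF *] have "(norm (h - a))\<^sup>2 \<le> (norm (h - a - b))\<^sup>2" by simp
    then have "norm (h - a) \<le> norm (h - a - b)" by (rule power2_le_imp_le) simp
    also have "\<dots> = dist p h" by (simp add: ab dist_norm norm_minus_commute diff_diff_eq)
    finally have ha: "norm (h - a) \<le> e" using p(2) by simp
    have "ip a w = 0"
      by (rule ortho[OF ab(2)]) (auto simp: P_def ip_cscale_left w)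
    then have "cmod (ip h w) = cmod (ip (h - a) w)" by (simp add: ip_diff_left)
    also have "\<dots> \<le> norm (h - a) * norm w" by (rule norm_ip_le)
    also have "\<dots> \<le> e * norm w" using ha by (intro mult_right_mono) auto
    finally show ?thesis .
  qed
  note bound = this
  have "cmod (ip h w) \<le> 0"
  proof (rule field_le_epsilon)
    fix e :: real assume "e > 0"
    \<comment> \<open>The summand 1 guards the division below against \<open>w = 0\<close>.\<close>
    have pos: "norm w + 1 > 0" by (simp add: add_nonneg_pos)
    have "cmod (ip h w) \<le> e / (norm w + 1) * norm w"
      using \<open>e > 0\<close> pos by (intro bound divide_pos_pos)
    also have "\<dots> \<le> e" using \<open>e > 0\<close> pos by (simp add: field_simps)
    finally show "cmod (ip h w) \<le> 0 + e" by simp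
  qed
  then show ?thesis by simp
qed

section \<open>Hardy and model spaces\<close>

lemma Hardy2_diff: "f \<in> Hardy2 \<Longrightarrow> g \<in> Hardy2 \<Longrightarrow> f - g \<in> Hardy2"
  by (simp add: Hardy2_def fourier_def ip_diff_left)

lemma Hardy2_cscale: "f \<in> Hardy2 \<Longrightarrow> cscale c f \<in> Hardy2"
  by (simp add: Hardy2_def fourier_def ip_cscale_left)

lemma Hardy2_monomial: "n \<ge> 0 \<Longrightarrow> monomial n \<in> Hardy2"
  by (simp add: Hardy2_def fourier_def ip_monomial)

text \<open>Moved to the other side, \<open>p\<close> becomes
  \<open>Mult (J p) (monomial k)\<close>, whose coefficients at \<open>n \<ge> 0\<close> are
  conjugates of those of \<open>p\<close> at \<open>k - n < 0\<close>.\<close>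

lemma Hinfty_Mult_Hardy2:
  assumes p: "p \<in> Hinfty" and h: "h \<in> Hardy2"
  shows "Mult p h \<in> Hardy2"
proof -
  have pL: "p \<in> Linfty" and pH: "p \<in> Hardy2" using p by (auto simp: Hinfty_def)
  have "ip h (Mult (J p) (monomial k)) = 0" if "k < 0" for k
  proof (rule Hardy2_orthogonal[OF h])
    fix n :: int assume "n \<ge> 0"
    have "ip (monomial n) (Mult (J p) (monomial k)) = ip (Mult (monomial n) p) (monomial k)"
      using pL by (simp add: Mult_commute flip: ip_Mult)
    also have "\<dots> = fourier p (k - n)"
      by (simp add: ip_Mult J_monomial Mult_monomial fourier_def)
    also have "\<dots> = 0" using pH \<open>n \<ge> 0\<close> that by (simp add: Hardy2_def)
    finally show "ip (monomial n) (Mult (J p) (monomial k)) = 0" .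
  qed
  then show ?thesis by (simp add: Hardy2_def fourier_def ip_Mult pL)
qed

text \<open>The zeroth coefficient is the value at the origin of the analytic extension, hence
  multiplicative. In the proof, \<open>J p\<close> minus its constant term has only negative
  frequencies and so is orthogonal to \<open>h\<close>.\<close>

lemma fourier_0_Mult:
  assumes p: "p \<in> Hinfty" and h: "h \<in> Hardy2"
  shows "fourier (Mult p h) 0 = fourier p 0 * fourier h 0"
proof -
  have pL: "p \<in> Linfty" and pH: "p \<in> Hardy2" using p by (auto simp: Hinfty_def)
  have "ip h (J p - cscale (cnj (fourier p 0)) (monomial 0)) = 0"
  proof (rule Hardy2_orthogonal[OF h])
    fix n :: int assume n: "n \<ge> 0"
    have "ip (monomial n) (J p) = ip p (J (monomial n))"
      using ip_J[of "J (monomial n)" p] by simp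
    also have "\<dots> = (if n = 0 then fourier p 0 else 0)"
      using pH n by (simp add: J_monomial fourier_def[symmetric] Hardy2_def)
    finally show "ip (monomial n) (J p - cscale (cnj (fourier p 0)) (monomial 0)) = 0"
      by (simp add: ip_diff_right ip_cscale_right ip_monomial)
  qed
  then show ?thesis
    by (simp add: fourier_def ip_Mult pL Mult_one_right ip_diff_right ip_cscale_right)
qed

section \<open>A contraction criterion for membership in H^2\<close>

lemma Mult_power_unimodular:
  assumes "unimodular p"
  shows "norm ((Mult p ^^ N) f) = norm f"
  by (induction N) (simp_all add: norm_unimodular_Mult assms)

text \<open>Formally \<open>X\<close> is an element of H^2 divided by
  \<open>1 - c * \<alpha>\<close>; the iteration plays the part of the Neumann series of the
  inverse.\<close>

lemma Hardy2_if_diff_Mult: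
  assumes \<alpha>: "inner_function \<alpha>" and c: "cmod c < 1"
    and X: "X - cscale c (Mult \<alpha> X) \<in> Hardy2"
  shows "X \<in> Hardy2"
proof -
  have inn: "\<alpha> \<in> Hinfty" "unimodular \<alpha>" "\<alpha> \<in> Linfty"
    using \<alpha> by (auto simp: inner_function_def Hinfty_def)
  \<comment> \<open>Multiplication by an inner function preserves H^2, so the hypothesis may be
    multiplied by any power of \<open>\<alpha>\<close>.\<close>
  have H: "(Mult \<alpha> ^^ N) X - cscale c ((Mult \<alpha> ^^ Suc N) X) \<in> Hardy2" for N
  proof (induction N)
    case (Suc N)
    from Hinfty_Mult_Hardy2[OF inn(1) Suc] show ?case
      by (simp add: Mult_diff Mult_cscale inn)
  qed (use X in simp)
  have "fourier X k = 0" if "k < 0" for k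
  proof -
    have step: "fourier ((Mult \<alpha> ^^ N) X) k = c * fourier ((Mult \<alpha> ^^ Suc N) X) k" for N
      using H[of N] that by (simp add: Hardy2_def fourier_def ip_diff_left ip_cscale_left)
    have iter: "fourier X k = c ^ N * fourier ((Mult \<alpha> ^^ N) X) k" for N
      by (induction N) (use step in \<open>simp_all add: mult_ac\<close>)
    \<comment> \<open>Multiplication by the unimodular \<open>\<alpha>\<close> preserves the norm,
      so only \<open>c ^ N\<close> changes the size.\<close>
    have bound: "cmod (fourier X k) \<le> cmod c ^ N * norm X" for N
    proof -
      have "cmod (fourier ((Mult \<alpha> ^^ N) X) k) \<le> norm X"
        using norm_ip_le[of "(Mult \<alpha> ^^ N) X" "monomial k"]
        by (simp add: fourier_def Mult_power_unimodular inn norm_unimodular)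
      then show ?thesis
        by (subst iter[of N]) (simp add: norm_mult norm_power mult_left_mono)
    qed
    have "(\<lambda>N. cmod c ^ N * norm X) \<longlonglongrightarrow> 0 * norm X"
      using c by (intro tendsto_mult_right LIMSEQ_power_zero) simp
    then have "cmod (fourier X k) \<le> 0 * norm X"
      by (rule LIMSEQ_le_const) (use bound in blast)
    then show ?thesis by simp
  qed
  then show ?thesis by (simp add: Hardy2_def)
qed

text \<open>By Pythagoras, 1 minus the squared modulus of \<open>a\<close> is the squared distance
  of \<open>\<alpha>\<close> to its constant term.\<close>

lemma inner_fourier_0_less_1:
  assumes "inner_function \<alpha>" "\<not> constant_function \<alpha>"
  shows "cmod (fourier \<alpha> 0) < 1"
proof -
  have n: "norm \<alpha> = 1"
    using assms(1) by (simp add: inner_function_def norm_unimodular)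
  define a where "a = fourier \<alpha> 0"
  have a: "ip \<alpha> (monomial 0) = a" "ip (monomial 0) \<alpha> = cnj a"
    "ip \<alpha> \<alpha> = 1" "ip (monomial 0) (monomial 0) = 1"
    by (simp_all add: a_def fourier_def cnj_ip ip_norm[of \<alpha>] n ip_monomial)
  have "complex_of_real ((norm (\<alpha> - cscale a (monomial 0)))\<^sup>2) = 1 - a * cnj a"
    unfolding ip_norm[symmetric]
    by (simp add: ip_diff_left ip_diff_right ip_cscale_left ip_cscale_right a mult.commute)
  also have "\<dots> = complex_of_real (1 - (cmod a)\<^sup>2)"
    by (simp add: complex_norm_square del: of_real_power)
  finally have *: "(norm (\<alpha> - cscale a (monomial 0)))\<^sup>2 = 1 - (cmod a)\<^sup>2"
    by (simp only: of_real_eq_iff)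
  have "\<alpha> - cscale a (monomial 0) \<noteq> 0"
    using assms(2) by (auto simp: constant_function_def)
  then have "(cmod a)\<^sup>2 < 1\<^sup>2" using * by (smt (verit) zero_less_norm_iff zero_less_power one_power2)
  then show ?thesis unfolding a_def by (rule power2_less_imp_less) simp
qed

text \<open>The reproducing kernel at the origin. Paired with \<open>Mult \<alpha> h\<close>, the
  constant 1 gives the conjugate of \<open>fourier \<alpha> 0 * fourier h 0\<close> and
  \<open>\<alpha>\<close> gives the conjugate of \<open>fourier h 0\<close>, so the two terms
  cancel.\<close>

lemma model_space_kernel:
  assumes \<alpha>: "inner_function \<alpha>"
  shows "monomial 0 - cscale (cnj (fourier \<alpha> 0)) \<alpha> \<in> model_space \<alpha>"
proof -
  have inn: "\<alpha> \<in> Hinfty" "\<alpha> \<in> Hardy2" "unimodular \<alpha>" "\<alpha> \<in> Linfty"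
    using \<alpha> by (auto simp: inner_function_def Hinfty_def)
  have "ip (monomial 0 - cscale (cnj (fourier \<alpha> 0)) \<alpha>) (Mult \<alpha> h) = 0" if h: "h \<in> Hardy2" for h
  proof -
    have "ip \<alpha> (Mult \<alpha> h) = ip (Mult \<alpha> (monomial 0)) (Mult \<alpha> h)"
      by (simp add: Mult_one_right)
    also have "\<dots> = cnj (fourier h 0)"
      by (simp add: ip_Mult inn unimodular_cancel fourier_def cnj_ip)
    finally have 1: "ip \<alpha> (Mult \<alpha> h) = cnj (fourier h 0)" .
    have "ip (monomial 0) (Mult \<alpha> h) = cnj (fourier (Mult \<alpha> h) 0)"
      by (simp add: fourier_def cnj_ip)
    then show ?thesis
      by (simp add: ip_diff_left ip_cscale_left 1 fourier_0_Mult inn h)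
  qed
  moreover have "monomial 0 - cscale (cnj (fourier \<alpha> 0)) \<alpha> \<in> Hardy2"
    by (intro Hardy2_diff Hardy2_cscale Hardy2_monomial inn) simp
  ultimately show ?thesis by (auto simp: model_space_def)
qed

text \<open>The image of the kernel function above under \<open>conj_inner \<alpha>\<close>.
  Removing the constant term of \<open>\<alpha>\<close> is what makes division by \<open>z\<close>
  possible within H^2.\<close>

lemma model_space_conj_kernel:
  assumes \<alpha>: "inner_function \<alpha>"
  shows "Mult (monomial (- 1)) (\<alpha> - cscale (fourier \<alpha> 0) (monomial 0)) \<in> model_space \<alpha>"
    (is "?k \<in> _")
proof -
  have inn: "\<alpha> \<in> Hinfty" "\<alpha> \<in> Hardy2" "unimodular \<alpha>" "\<alpha> \<in> Linfty"
    using \<alpha> by (auto simp: inner_function_def Hinfty_def)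
  have "fourier ?k n = 0" if "n < 0" for n
  proof -
    have "fourier ?k n = fourier (\<alpha> - cscale (fourier \<alpha> 0) (monomial 0)) (n + 1)"
      by (simp add: fourier_def ip_Mult J_monomial Mult_monomial add.commute)
    also have "\<dots> = 0"
    \<comment> \<open>The borderline \<open>n = - 1\<close> reads off the constant term, which has
      been subtracted.\<close>
    proof (cases "n + 1 = 0")
      case True
      then show ?thesis
        by (simp only: fourier_def) (simp add: fourier_def ip_diff_left ip_cscale_left ip_monomial)
    next
      case False
      with that have "n + 1 < 0" by simp
      with inn(2) have "fourier \<alpha> (n + 1) = 0" by (simp add: Hardy2_def)
      then show ?thesis using False by (simp add: fourier_def ip_diff_left ip_cscale_left ip_monomial)
    qed
    finally show ?thesis .
  qed
  then have "?k \<in> Hardy2" by (simp add: Hardy2_def)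
  moreover have "ip ?k (Mult \<alpha> h) = 0" if h: "h \<in> Hardy2" for h
  proof -
    \<comment> \<open>Functions \<open>z g\<close> with \<open>g\<close> in H^2 have mean zero; this
      is applied to \<open>h\<close> and to \<open>Mult \<alpha> h\<close>.\<close>
    have zg: "ip (monomial 0) (Mult (monomial 1) g) = 0" if "g \<in> Hardy2" for g
    proof -
      have "ip (Mult (monomial 1) g) (monomial 0) = fourier g (- 1)"
        by (simp add: ip_Mult J_monomial fourier_def Mult_one_right)
      also have "\<dots> = 0" using that by (simp add: Hardy2_def)
      finally show ?thesis by (subst cnj_ip[symmetric]) simp
    qed
    have "ip \<alpha> (Mult (monomial 1) (Mult \<alpha> h)) = ip (Mult \<alpha> (monomial 0)) (Mult \<alpha> (Mult (monomial 1) h))"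
      by (simp add: Mult_one_right Mult_left_commute inn)
    also have "\<dots> = ip (monomial 0) (Mult (monomial 1) h)"
      by (subst ip_Mult) (simp_all add: inn unimodular_cancel)
    finally have "ip \<alpha> (Mult (monomial 1) (Mult \<alpha> h)) = 0" using zg[OF h] by simp
    then show ?thesis
      using zg[OF Hinfty_Mult_Hardy2[OF inn(1) h]]
      by (simp add: ip_Mult J_monomial ip_diff_left ip_cscale_left)
  qed
  ultimately show ?thesis by (auto simp: model_space_def)
qed

text \<open>The coefficient of the image at \<open>n < 0\<close> is the conjugate of a pairing of
  \<open>g\<close> with \<open>\<theta>\<close> times the monomial of exponent
  \<open>- 1 - n \<ge> 0\<close>, an element of \<open>\<theta>\<close> times H^2.\<close>

lemma conj_inner_model_space:
  assumes \<theta>: "inner_function \<theta>" and g: "g \<in> model_space \<theta>"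
  shows "conj_inner \<theta> g \<in> Hardy2"
proof -
  have inn: "\<theta> \<in> Linfty" using \<theta> by (auto simp: inner_function_def Hinfty_def)
  have "fourier (conj_inner \<theta> g) n = 0" if "n < 0" for n
  proof -
    have "fourier (conj_inner \<theta> g) n = ip (J (Mult (monomial 1) g)) (Mult (J \<theta>) (monomial n))"
      by (simp add: fourier_def conj_inner_def ip_Mult inn)
    also have "\<dots> = ip (J (Mult (J \<theta>) (monomial n))) (Mult (monomial 1) g)"
      using ip_J[of "Mult (monomial 1) g" "J (Mult (J \<theta>) (monomial n))"] by simp
    also have "\<dots> = ip (Mult \<theta> (monomial (- 1 - n))) g"
      using ip_Mult[of "monomial (- 1)" "Mult \<theta> (monomial (- n))" g]
      by (simp add: J_Mult J_monomial Mult_left_commute[of _ \<theta>] inn Mult_monomial)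
    also have "\<dots> = cnj (ip g (Mult \<theta> (monomial (- 1 - n))))" by (simp add: cnj_ip)
    also have "ip g (Mult \<theta> (monomial (- 1 - n))) = 0"
    proof -
      have "monomial (- 1 - n) \<in> Hardy2" using that by (intro Hardy2_monomial) simp
      then show ?thesis using g by (simp add: model_space_def)
    qed
    finally show ?thesis by simp
  qed
  then show ?thesis by (simp add: Hardy2_def)
qed

section \<open>Operators commuting with the shift\<close>

lemma conjugation_ip:
  assumes "conjugation C"
  shows "ip (C f) g = ip (C g) f"
proof -
  have "C (C g) = g" using assms by (metis conjugation_def comp_apply id_apply)
  then have "ip (C f) g = ip (C f) (C (C g))" by simp
  also have "\<dots> = ip (C g) f" using assms by (simp add: conjugation_def)
  finally show ?thesis .
qed

lemma adj_eqI:
  assumes "\<And>f g. ip (T f) g = ip f (S g)"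
  shows "adj T = S"
  unfolding adj_def
proof (rule the_equality)
  fix S' assume S': "\<forall>f g. ip (T f) g = ip f (S' g)"
  show "S' = S"
  proof
    fix g
    show "S' g = S g"
    proof (rule ip_eqI)
      fix h
      have "ip h (S' g) = ip h (S g)" using assms S' by metis
      then show "ip (S' g) h = ip (S g) h" by (metis cnj_ip)
    qed
  qed
qed (use assms in blast)

text \<open>The equality case of Cauchy-Schwarz: pairing the real part with \<open>f\<close> gives
  \<open>inner (U f) f = (norm f)\<^sup>2\<close>, while \<open>U f\<close> is no longer than
  \<open>f\<close>.\<close>

lemma isometry_Re_id:
  assumes adj: "\<And>f g. ip (U f) g = ip f (V g)" and iso: "\<And>f. norm (U f) = norm f"
    and re: "\<And>f. cscale (1 / 2) (U f + V f) = f"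
  shows "U f = f"
proof -
  have "cscale 2 (cscale (1 / 2) (U f + V f)) = cscale 2 f" by (simp only: re)
  then have "U f + V f = cscale 2 f" by simp
  then have "ip (U f + V f) f = 2 * ip f f" by (simp add: ip_cscale_left)
  moreover have "ip (V f) f = cnj (ip (U f) f)"
    by (simp add: adj cnj_ip)
  ultimately have "Re (ip (U f) f) = Re (ip f f)"
    by (simp add: ip_add_left complex_eq_iff)
  then have 1: "inner (U f) f = (norm f)\<^sup>2"
    by (simp add: inner_L2_def ip_norm)
  have "(norm (U f - f))\<^sup>2 = (norm (U f))\<^sup>2 - 2 * inner (U f) f + (norm f)\<^sup>2"
    by (simp add: power2_norm_eq_inner inner_diff_left inner_diff_right inner_commute)
  then have "(norm (U f - f))\<^sup>2 = 0" by (simp add: 1 iso)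
  then show ?thesis by simp
qed

lemma Re_op_id_imp_commute:
  assumes C: "conjugation C"
    and re: "Re_op (adj (Mult (monomial 1) \<circ> C \<circ> J \<circ> Mult (monomial (- 1))) \<circ> (C \<circ> J)) = id"
  shows "Mult (monomial 1) (C (Mult (monomial 1) f)) = C f"
proof -
  let ?z = "Mult (monomial 1)" and ?zb = "Mult (monomial (- 1))"
  have CC [simp]: "C (C f) = f" for f using C by (metis conjugation_def comp_apply id_apply)
  have ipC: "ip (C f) (C g) = ip g f" for f g using C by (simp add: conjugation_def)
  have ipz: "ip (?z f) g = ip f (?zb g)" "ip (?zb f) g = ip f (?z g)" for f g
    by (simp_all add: ip_Mult J_monomial)
  have zz [simp]: "?z (?zb f) = f" "?zb (?z f) = f" for f
    by (simp_all add: Mult_monomial_left)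
  have ipJ: "ip (J f) g = ip (J g) f" for f g using ip_J[of f "J g"] by simp
  have ipCJ: "ip (C (J f)) g = ip f (J (C g))" for f g
    using conjugation_ip[OF C, of "J f" g] ip_J[of "J (C g)" f] by simp
  have ipJC: "ip (J (C f)) g = ip f (C (J g))" for f g
    using ipCJ[of g f] by (metis cnj_ip)
  \<comment> \<open>\<open>C \<circ> J\<close> has adjoint \<open>J \<circ> C\<close>, and the two
    shifts are adjoint to each other.\<close>
  have adjB: "adj (?z \<circ> C \<circ> J \<circ> ?zb) = ?z \<circ> J \<circ> C \<circ> ?zb"
    by (rule adj_eqI) (simp add: ipz ipCJ)
  \<comment> \<open>\<open>?U\<close> is the operator of (ii) with its inner adjoint written out,
    and \<open>?V\<close> is the adjoint of \<open>?U\<close>.\<close>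
  let ?U = "\<lambda>f. ?z (J (C (?zb (C (J f)))))" and ?V = "\<lambda>f. J (C (?z (C (J (?zb f)))))"
  have adjU: "ip (?U f) g = ip f (?V g)" for f g
    by (simp add: ipz ipJC ipCJ)
  have "adj (?z \<circ> J \<circ> C \<circ> ?zb \<circ> (C \<circ> J)) = ?V"
    by (rule adj_eqI) (simp add: adjU)
  then have re': "cscale (1 / 2) (?U f + ?V f) = f" for f
    using fun_cong[OF re, of f] by (simp add: Re_op_def adjB)
  have "norm (?U f) = norm f" for f
    by (rule norm_eqI) (simp add: ipz ipC ip_J)
  then have U: "?U f = f" for f
    using isometry_Re_id[of ?U ?V f] adjU re' by blast
  \<comment> \<open>The maps in front of \<open>?U\<close> cancel against its factors and leave
    \<open>C f\<close>. Once \<open>?U\<close> is the identity, the same expression is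
    \<open>?z (C (?z f))\<close>.\<close>
  have "?z (C (J (?zb (?U (J f))))) = C f" by (simp only: zz CC J_J)
  then have "?z (C (J (?zb (J f)))) = C f" by (simp only: U)
  then show ?thesis by (simp add: J_Mult J_monomial)
qed

section \<open>Isometries commuting with the bilateral shift\<close>

lemma commute_monomial:
  assumes "\<And>f. A (Mult (monomial 1) f) = Mult (monomial 1) (A f)"
  shows "A (monomial n) = Mult (monomial n) (A (monomial 0))"
proof -
  have pos: "A (Mult (monomial (int k)) f) = Mult (monomial (int k)) (A f)" for k f
  proof (induction k)
    case (Suc k)
    have "Mult (monomial (int (Suc k))) g = Mult (monomial 1) (Mult (monomial (int k)) g)" for g
      by (simp add: Mult_monomial_left)
    then show ?case by (simp only: assms Suc)
  qed simp
  show ?thesis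
  proof (cases "n \<ge> 0")
    case True
    then obtain k where n: "n = int k" by (rule nonneg_int_cases)
    show ?thesis using pos[of k "monomial 0"] by (simp add: n Mult_monomial)
  next
    case False
    then have n: "n = - int (nat (- n))" by simp
    then obtain k where n: "n = - int k" ..
    \<comment> \<open>For negative \<open>n\<close> the rule for the positive power
      \<open>k = - n\<close> is applied to \<open>monomial n\<close> itself; the product is the
      constant 1, and the power is then cancelled.\<close>
    have "A (monomial 0) = Mult (monomial (int k)) (A (monomial n))"
      using pos[of k "monomial n"] by (simp add: n Mult_monomial)
    then show ?thesis by (simp add: n Mult_monomial_left)
  qed
qed

text \<open>Testing with indicators \<open>h\<close> shows that the squared modulus of
  \<open>f\<close> minus 1 integrates to 0 over every measurable set.\<close>

lemma unimodular_if_isometric_Mult: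
  assumes "\<And>h. h \<in> Linfty \<Longrightarrow> norm (Mult h f) = norm h"
  shows "unimodular f"
proof -
  obtain p where p: "square_integrable p" "f = abs_L2 p" by (rule L2_cases)
  have pm [measurable]: "p \<in> borel_measurable circle" and pi: "integrable circle (\<lambda>z. (cmod (p z))\<^sup>2)"
    using p(1) by (auto simp: square_integrable_def)
  interpret prob_space circle by (rule prob_space_circle)
  have "AE z in circle. (cmod (p z))\<^sup>2 - 1 = 0"
  proof (rule density_zero)
    show "integrable circle (\<lambda>z. (cmod (p z))\<^sup>2 - 1)" using pi by simp
    fix A assume A [measurable]: "A \<in> sets circle"
    define h :: "complex \<Rightarrow> complex" where "h = indicator A"
    have hb: "AE z in circle. cmod (h z) \<le> 1" by (auto simp: h_def indicator_def)
    have h: "square_integrable h"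
      using A hb by (intro square_integrableI_bounded[where B = 1]) (auto simp: h_def)
    have hp: "square_integrable (\<lambda>z. h z * p z)"
      using h hb p(1) by (intro square_integrable_mult exI)
    have "abs_L2 h \<in> Linfty"
      using h hb by (auto simp: Linfty_def ess_bounded.abs_eq)
    then have "(norm (Mult (abs_L2 h) f))\<^sup>2 = (norm (abs_L2 h))\<^sup>2" by (simp add: assms)
    moreover have "Mult (abs_L2 h) f = abs_L2 (\<lambda>z. h z * p z)"
      using h p hp by (simp add: Mult.abs_eq)
    ultimately have "(LINT z|circle. (cmod (h z * p z))\<^sup>2) = (LINT z|circle. (cmod (h z))\<^sup>2)"
      using h hp by (simp add: norm_abs_L2)
    moreover have "integrable circle (\<lambda>z. (cmod (h z * p z))\<^sup>2)" "integrable circle (\<lambda>z. (cmod (h z))\<^sup>2)"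
      using h hp by (auto simp: square_integrable_def)
    ultimately have "(LINT z|circle. (cmod (h z * p z))\<^sup>2 - (cmod (h z))\<^sup>2) = 0" by simp
    also have "(\<lambda>z. (cmod (h z * p z))\<^sup>2 - (cmod (h z))\<^sup>2) = (\<lambda>z. indicator A z *\<^sub>R ((cmod (p z))\<^sup>2 - 1))"
      by (auto simp: h_def indicator_def)
    finally show "set_lebesgue_integral circle A (\<lambda>z. (cmod (p z))\<^sup>2 - 1) = 0"
      by (simp add: set_lebesgue_integral_def)
  qed
  then have "AE z in circle. cmod (p z) = 1"
  proof eventually_elim
    case (elim z)
    then have "(cmod (p z))\<^sup>2 = 1\<^sup>2" by simp
    then show ?case by (rule power2_eq_imp_eq) auto
  qed
  then show ?thesis using p by (simp add: unimodular.abs_eq)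
qed

text \<open>The symbol \<open>\<psi>\<close> is at first only in L^2, so the formula is shown for
  bounded \<open>h\<close>. There the isometry makes \<open>\<psi>\<close> unimodular, hence
  bounded, and the formula extends to all \<open>f\<close>.\<close>

lemma isometry_commuting_with_shift:
  assumes add: "\<And>f g. A (f + g) = A f + A g" and scale: "\<And>c f. A (cscale c f) = cscale c (A f)"
    and iso: "\<And>f. norm (A f) = norm f"
    and comm: "\<And>f. A (Mult (monomial 1) f) = Mult (monomial 1) (A f)"
  shows "unimodular (A (monomial 0))" "A f = Mult (A (monomial 0)) f"
proof -
  define \<psi> where "\<psi> = A (monomial 0)"
  have blA: "bounded_linear A"
    by (rule bounded_linear_intro[where K = 1]) (simp_all add: add scaleR_L2_def scale iso)
  \<comment> \<open>The right side avoids the product of \<open>\<psi>\<close> and \<open>f\<close>: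
    \<open>J \<psi>\<close> times a monomial always lies in L^2, so both sides are bounded linear in
    \<open>f\<close>.\<close>
  have Af: "ip (A f) (monomial n) = ip f (Mult (J \<psi>) (monomial n))" for f n
  proof (rule bounded_linear_eq_on_monomials[OF bounded_linear_compose[OF bounded_linear_ip_left blA]
        bounded_linear_ip_left, unfolded o_def])
    fix c m
    have "ip (A (monomial m)) (monomial n) = ip (monomial m) (Mult (J \<psi>) (monomial n))"
      unfolding commute_monomial[where A = A and n = m, OF comm] \<psi>_def[symmetric] by (rule ip_Mult_swap) simp_all
    then show "ip (A (cscale c (monomial m))) (monomial n) = ip (cscale c (monomial m)) (Mult (J \<psi>) (monomial n))"
      by (simp add: scale ip_cscale_left)
  qed
  have bdd: "A h = Mult h \<psi>" if "h \<in> Linfty" for h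
    by (rule fourier_eqI) (simp add: Af ip_Mult_swap that)
  have uni: "unimodular \<psi>"
    by (rule unimodular_if_isometric_Mult) (simp add: iso flip: bdd)
  show "unimodular (A (monomial 0))" using uni by (simp add: \<psi>_def)
  show "A f = Mult (A (monomial 0)) f"
    unfolding \<psi>_def[symmetric]
    by (rule fourier_eqI) (simp add: Af ip_Mult unimodular_Linfty[OF uni])
qed

section \<open>The symbol of \<open>C\<close> and the two divisibilities\<close>

theorem theorem5p5:
  fixes \<alpha> \<theta> :: L2 and C :: "L2 \<Rightarrow> L2"
  assumes "inner_function \<alpha>" and "\<not> constant_function \<alpha>"
    and "inner_function \<theta>" and "\<not> constant_function \<theta>"
    and "conjugation C"
    and "C \<circ> Mult (monomial 2) = Mult (monomial (- 2)) \<circ> C"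
    and "C ` model_space \<alpha> \<subseteq> model_space \<theta>"
    and "(Mult (monomial 1) \<circ> C \<circ> Mult (monomial 1)) ` model_space \<alpha> \<subseteq> model_space \<theta>"
    and "Re_op (adj (Mult (monomial 1) \<circ> C \<circ> J \<circ> Mult (monomial (- 1))) \<circ> (C \<circ> J)) = id"
  shows "\<exists>\<gamma>. inner_function \<gamma> \<and>
    (\<lambda>f. C f + Mult (monomial 1) (C (Mult (monomial 1) f))) = (\<lambda>f. cscale 2 (conj_inner \<gamma> f)) \<and>
    inner_divides \<alpha> \<gamma> \<and> inner_divides \<gamma> \<theta>"
proof -
  have inn: "unimodular \<alpha>" "unimodular \<theta>" "\<alpha> \<in> Hinfty" "\<alpha> \<in> Linfty" "\<theta> \<in> Linfty"
    using assms(1,3) by (auto simp: inner_function_def Hinfty_def)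
  have zCz: "Mult (monomial 1) (C (Mult (monomial 1) f)) = C f" for f
    using assms(5,9) by (rule Re_op_id_imp_commute)
  \<comment> \<open>The symbol of \<open>C \<circ> J\<close> is its value at the constant 1, which
    \<open>J\<close> fixes.\<close>
  define \<psi> where "\<psi> = C (monomial 0)"
  have add: "C (J (f + g)) = C (J f) + C (J g)" and scale: "C (J (cscale c f)) = cscale c (C (J f))"
    and iso: "norm (C (J f)) = norm f" for f g c
    using assms(5) by (auto simp: conjugation_def J_add J_cscale ip_J intro!: norm_eqI)
  have comm: "C (J (Mult (monomial 1) f)) = Mult (monomial 1) (C (J f))" for f
    using zCz[of "Mult (monomial (- 1)) (J f)"]
    by (simp add: J_Mult J_monomial Mult_monomial_left)
  note CJ = isometry_commuting_with_shift[where A = "\<lambda>f. C (J f)", OF add scale iso comm]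
  have C: "C f = Mult \<psi> (J f)" for f
    using CJ(2)[of "J f"] by (simp add: \<psi>_def J_monomial)
  have \<psi>: "unimodular \<psi>" "\<psi> \<in> Linfty"
    using CJ(1) by (simp_all add: \<psi>_def J_monomial unimodular_Linfty)
  \<comment> \<open>The factor \<open>z\<close> compensates the conjugate of \<open>z\<close>
    contained in \<open>conj_inner\<close>.\<close>
  define \<gamma> where "\<gamma> = Mult (monomial 1) \<psi>"
  have \<gamma>: "unimodular \<gamma>" "\<gamma> \<in> Linfty"
    using \<psi> by (simp_all add: \<gamma>_def unimodular_Mult)
  define a where "a = fourier \<alpha> 0"
  have a: "cmod (cnj a) < 1"
    using inner_fourier_0_less_1[OF assms(1,2)] by (simp add: a_def)
  have C\<gamma>: "C f = conj_inner \<gamma> f" for f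
    by (simp add: C conj_inner_def \<gamma>_def J_Mult J_monomial Mult_assoc \<psi>
        Mult_left_commute[of "monomial 1" \<psi>] Mult_monomial_left)

  have mem: "C k \<in> model_space \<theta>" if "k \<in> model_space \<alpha>" for k
    using assms(7) that by auto
  have "Mult \<gamma> (J \<alpha>) \<in> Hardy2"
  proof (rule Hardy2_if_diff_Mult[OF assms(1) a])
    \<comment> \<open>With \<open>X = Mult \<gamma> (J \<alpha>)\<close>, so that
      \<open>Mult \<alpha> X = \<gamma>\<close>, the conjugate kernel is sent to
      \<open>Mult \<gamma> (J \<alpha>) - cscale (cnj a) \<gamma>\<close>, which has the form
      required by the contraction criterion.\<close>
    have "C (Mult (monomial (- 1)) (\<alpha> - cscale a (monomial 0))) \<in> Hardy2"
      using mem[OF model_space_conj_kernel[OF assms(1)]] by (simp add: a_def model_space_def)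
    also have "C (Mult (monomial (- 1)) (\<alpha> - cscale a (monomial 0)))
        = Mult \<gamma> (J \<alpha>) - cscale (cnj a) (Mult \<alpha> (Mult \<gamma> (J \<alpha>)))"
      by (simp add: C\<gamma> conj_inner_def Mult_monomial_left J_diff J_cscale J_monomial Mult_diff
          Mult_cscale \<gamma> Mult_left_commute[of \<alpha>] inn unimodular_Mult_J)
    finally show "Mult \<gamma> (J \<alpha>) - cscale (cnj a) (Mult \<alpha> (Mult \<gamma> (J \<alpha>))) \<in> Hardy2" .
  qed
  then have \<alpha>\<gamma>: "inner_divides \<alpha> \<gamma>"
    using \<gamma> inn by (simp add: inner_divides_def inner_function_def Hinfty_def unimodular_Mult unimodular_J)
  have "Mult \<theta> (J \<gamma>) \<in> Hardy2"
  proof (rule Hardy2_if_diff_Mult[OF assms(1) a])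
    \<comment> \<open>The conjugations of \<open>\<gamma>\<close> and \<open>\<theta>\<close>
      compose to multiplication by \<open>X = Mult \<theta> (J \<gamma>)\<close>, so the kernel
      function \<open>k\<close> is sent to the product of \<open>X\<close> and
      \<open>k\<close>.\<close>
    have "conj_inner \<theta> (C (monomial 0 - cscale (cnj a) \<alpha>)) \<in> Hardy2"
      using mem[OF model_space_kernel[OF assms(1)]] assms(3) by (simp add: a_def conj_inner_model_space)
    also have "conj_inner \<theta> (C (monomial 0 - cscale (cnj a) \<alpha>))
        = Mult \<theta> (J \<gamma>) - cscale (cnj a) (Mult \<alpha> (Mult \<theta> (J \<gamma>)))"
      by (simp add: C conj_inner_def \<gamma>_def J_Mult J_diff J_cscale J_monomial Mult_diff Mult_cscale
          \<psi> inn Mult_left_commute[of \<alpha>] Mult_commute[of _ \<alpha>] Mult_one_right)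
    finally show "Mult \<theta> (J \<gamma>) - cscale (cnj a) (Mult \<alpha> (Mult \<theta> (J \<gamma>))) \<in> Hardy2" .
  qed
  then have \<gamma>\<theta>: "inner_divides \<gamma> \<theta>"
    using \<gamma> inn by (simp add: inner_divides_def inner_function_def Hinfty_def unimodular_Mult unimodular_J)
  \<comment> \<open>Multiplying the inner quotient by \<open>\<alpha>\<close> recovers
    \<open>\<gamma>\<close>, which is thereby in H^2.\<close>
  have "Mult \<alpha> (Mult \<gamma> (J \<alpha>)) \<in> Hardy2"
    using inn(3) \<open>Mult \<gamma> (J \<alpha>) \<in> Hardy2\<close> by (rule Hinfty_Mult_Hardy2)
  then have "\<gamma> \<in> Hardy2"
    by (simp add: Mult_left_commute[of \<alpha>] \<gamma> inn unimodular_Mult_J Mult_one_right)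
  then have "inner_function \<gamma>" using \<gamma> by (simp add: inner_function_def Hinfty_def)
  \<comment> \<open>By \<open>zCz\<close> both summands equal \<open>C f\<close>.\<close>
  moreover have "C f + Mult (monomial 1) (C (Mult (monomial 1) f)) = cscale 2 (conj_inner \<gamma> f)" for f
    using cscale_add_left[of 1 1 "C f"] by (simp add: zCz flip: C\<gamma>)
  ultimately show ?thesis using \<alpha>\<gamma> \<gamma>\<theta> by blast
qed

end
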